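(* For every integer $n\geq 3$ there exist full-dimensional zonoids $A,B\subset\mathbb{R}^n$ and a unit vector $u\in\mathbb{S}^{n-1}$ such that $$\frac{|A+B|}{|P_{u^\perp}(A+B)|_{n-1}}<\frac{|A|}{|P_{u^\perp}A|_{n-1}}+\frac{|B|}{|P_{u^\perp}B|_{n-1}}.$$
   Context: A zonotope is a finite Minkowski sum of segments; a zonoid is a limit of zonotopes in the Hausdorff metric. $|K|$ is $n$-dimensional Lebesgue measure, $|K|_{n-1}$ is $(n-1)$-dimensional Hausdorff measure, $A+B$ is the Minkowski sum, and $P_{u^\perp}$ is the orthogonal projection onto the hyperplane $u^\perp$. *)

theory Defs
  imports "HOL-Analysis.Analysis"
begin

text \<open>The operation \<open>+\<close> on sets, and finite sums of sets, are those of
  \<open>HOL-Library.Set_Algebras\<close>, i.e. Minkowski sums.\<close>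

definition zonotope :: "'a::real_vector set \<Rightarrow> bool" where
  "zonotope Z \<longleftrightarrow>
     (\<exists>(m::nat) a b. Z = (\<Sum>i<m. closed_segment (a i) (b i)))"

text \<open>The real-valued suprema are meaningful only for nonempty bounded sets;
  the distance is used only for nonempty compact ones.\<close>

definition hausdorff_dist :: "'a::metric_space set \<Rightarrow> 'a set \<Rightarrow> real" where
  "hausdorff_dist A B =
     max (SUP a\<in>A. infdist a B) (SUP b\<in>B. infdist b A)"

definition zonoid :: "'a::real_normed_vector set \<Rightarrow> bool" where
  "zonoid K \<longleftrightarrow> compact K \<and> K \<noteq> {} \<and>
     (\<exists>Z. (\<forall>k::nat. zonotope (Z k)) \<and> (\<lambda>k. hausdorff_dist (Z k) K) \<longlonglongrightarrow> 0)"

definition full_dimensional :: "'a::euclidean_space set \<Rightarrow> bool" where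
  "full_dimensional K \<longleftrightarrow> aff_dim K = int DIM('a)"

text \<open>For a unit vector \<open>u\<close>, the orthogonal projection onto the hyperplane
  orthogonal to \<open>u\<close>.\<close>

definition hyperplane_proj :: "'a::real_inner \<Rightarrow> 'a \<Rightarrow> 'a" where
  "hyperplane_proj u x = x - (x \<bullet> u) *\<^sub>R u"

lemma hyperplane_proj_eq_closest_point:
  fixes u x :: "'a::euclidean_space"
  assumes "norm u = 1"
  shows "hyperplane_proj u x = closest_point {y. u \<bullet> y = 0} x"
proof (rule closest_point_unique)
  have uu: "u \<bullet> u = 1"
    using assms by (simp add: norm_eq_1)
  show "convex {y. u \<bullet> y = 0}" "closed {y. u \<bullet> y = 0}"
    by (simp_all add: convex_hyperplane closed_hyperplane)
  show "hyperplane_proj u x \<in> {y. u \<bullet> y = 0}"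
    by (simp add: hyperplane_proj_def inner_diff_right uu inner_commute)
  show "\<forall>z\<in>{y. u \<bullet> y = 0}. dist x (hyperplane_proj u x) \<le> dist x z"
  proof
    fix z assume "z \<in> {y. u \<bullet> y = 0}"
    then have "x \<bullet> u = (x - z) \<bullet> u"
      by (simp add: inner_diff_left inner_diff_right inner_commute)
    then have "\<bar>x \<bullet> u\<bar> \<le> norm (x - z)"
      using Cauchy_Schwarz_ineq2[of "x - z" u] assms by simp
    then show "dist x (hyperplane_proj u x) \<le> dist x z"
      by (simp add: hyperplane_proj_def dist_norm assms)
  qed
qed

text \<open>The \<open>d\<close>-dimensional Hausdorff (outer) measure. It is normalised by the volume of
  the \<open>d\<close>-dimensional unit ball, the usual convention under which it agrees with
  Lebesgue measure on \<open>d\<close>-dimensional subspaces. The empty set is treated separately because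
  \<open>0 ^ 0 = 1\<close>, and boundedness is required because \<open>diameter\<close> is unspecified on
  unbounded sets.\<close>

definition hausdorff_premeasure ::
    "nat \<Rightarrow> real \<Rightarrow> 'a::metric_space set \<Rightarrow> ennreal" where
  "hausdorff_premeasure d \<delta> S =
     (INF U \<in> {U :: nat \<Rightarrow> 'a set.
                 S \<subseteq> (\<Union>i. U i) \<and> (\<forall>i. bounded (U i) \<and> diameter (U i) \<le> \<delta>)}.
        \<Sum>i. if U i = {} then 0
             else ennreal (unit_ball_vol (real d) * (diameter (U i) / 2) ^ d))"

definition hausdorff_measure :: "nat \<Rightarrow> 'a::metric_space set \<Rightarrow> ennreal" where
  "hausdorff_measure d S = (SUP \<delta>\<in>{0<..}. hausdorff_premeasure d \<delta> S)"

end

theory Submission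
  imports Defs
begin

text \<open>
  For \<open>n = 3\<close> let \<open>A\<close> and \<open>B\<close> be the sums of the segments from the origin to
  \<open>e\<^sub>1, e\<^sub>2, (1,1,1), (1,1,-1)\<close> and to \<open>e\<^sub>1, e\<^sub>2, (1,-1,1), (1,-1,-1)\<close>, and let \<open>u = e\<^sub>3\<close>.
  The volume of a zonotope is the sum of the absolute determinants of the triples of its
  generators, and the area of its projection is the volume obtained after projecting the
  generators and adjoining \<open>u\<close>. This gives the ratios \<open>6/5\<close> and \<open>6/5\<close> for \<open>A\<close> and \<open>B\<close>, but
  \<open>64/28 < 12/5\<close> for \<open>A + B\<close>. For \<open>n > 3\<close> one adds the unit segments in the remaining
  coordinate directions, which changes none of the ratios.

  The determinant formula follows without decomposing the zonotope: the volume is affine in the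
  multiplicity of each generator and homogeneous of degree 3. Since only ratios matter,
  the Hausdorff measure on a hyperplane is needed only up to a constant factor, so no
  isodiametric inequality enters.
\<close>

subsection \<open>Hausdorff measure\<close>

text \<open>Lets two countable covers be merged at even and odd indices: partial sums of even length
  split exactly, and they dominate the others because all terms are nonnegative.\<close>

lemma suminf_interleave_le:
  fixes f g :: "nat \<Rightarrow> ennreal"
  shows "(\<Sum>n. if even n then f (n div 2) else g (n div 2)) \<le> suminf f + suminf g"
proof -
  let ?h = "\<lambda>n. if even n then f (n div 2) else g (n div 2)"
  have eq: "sum ?h {..<2 * n} = sum f {..<n} + sum g {..<n}" for n
    by (induction n) (auto simp: algebra_simps)
  have "sum ?h {..<n} \<le> suminf f + suminf g" for n
  proof -
    have "sum ?h {..<n} \<le> sum ?h {..<2 * n}"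
      by (rule sum_mono2) auto
    also have "\<dots> \<le> suminf f + suminf g"
      unfolding eq by (intro add_mono sum_le_suminf) auto
    finally show ?thesis .
  qed
  then show ?thesis
    by (subst suminf_eq_SUP) (rule SUP_least)
qed

lemma hausdorff_premeasure_mono:
  "S \<subseteq> T \<Longrightarrow> hausdorff_premeasure d \<delta> S \<le> hausdorff_premeasure d \<delta> T"
  unfolding hausdorff_premeasure_def by (rule INF_superset_mono) auto

text \<open>\<open>S\<close> followed by empty sets is an admissible cover, and empty sets cost
  nothing.\<close>

lemma hausdorff_premeasure_le_content:
  assumes "bounded S" "diameter S \<le> \<delta>" "\<delta> > 0"
  shows "hausdorff_premeasure d \<delta> S \<le> ennreal (unit_ball_vol (real d) * (diameter S / 2) ^ d)"
proof -
  define U where "U i = (if i = (0::nat) then S else {})" for i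
  have U: "S \<subseteq> (\<Union>i. U i) \<and> (\<forall>i. bounded (U i) \<and> diameter (U i) \<le> \<delta>)"
    using assms by (auto simp: U_def intro: exI[of _ 0])
  have "hausdorff_premeasure d \<delta> S \<le> (\<Sum>i. if U i = {} then 0
      else ennreal (unit_ball_vol (real d) * (diameter (U i) / 2) ^ d))"
    unfolding hausdorff_premeasure_def by (rule INF_lower) (use U in auto)
  also have "\<dots> = (if U 0 = {} then 0
      else ennreal (unit_ball_vol (real d) * (diameter (U 0) / 2) ^ d))"
    by (subst suminf_finite[of "{0}"]) (auto simp: U_def)
  finally show ?thesis
    by (auto simp: U_def split: if_splits)
qed

lemma hausdorff_premeasure_empty [simp]:
  assumes "\<delta> > 0" shows "hausdorff_premeasure d \<delta> ({} :: 'a::metric_space set) = 0"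
proof -
  have "hausdorff_premeasure d \<delta> ({} :: 'a set) \<le> (\<Sum>i::nat. if ({} :: 'a set) = {} then 0
      else ennreal (unit_ball_vol (real d) * (diameter ({} :: 'a set) / 2) ^ d))"
    unfolding hausdorff_premeasure_def
    by (rule INF_lower2[where i="\<lambda>_. {}"]) (use assms in auto)
  then show ?thesis by simp
qed

text \<open>Nearly optimal covers of the two sets are interleaved into a single cover of the
  union.\<close>

lemma hausdorff_premeasure_Un_le:
  "hausdorff_premeasure d \<delta> (S \<union> T)
     \<le> hausdorff_premeasure d \<delta> S + hausdorff_premeasure d \<delta> T"
proof -
  let ?c = "\<lambda>U. if U = {} then 0
      else ennreal (unit_ball_vol (real d) * (diameter U / 2) ^ d)"
  let ?C = "\<lambda>S. {U :: nat \<Rightarrow> 'a set.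
      S \<subseteq> (\<Union>i. U i) \<and> (\<forall>i. bounded (U i) \<and> diameter (U i) \<le> \<delta>)}"
  have *: "hausdorff_premeasure d \<delta> (S \<union> T) \<le> (\<Sum>i. ?c (U i)) + (\<Sum>i. ?c (V i))"
    if U: "U \<in> ?C S" and V: "V \<in> ?C T" for U V
  proof -
    define W where "W i = (if even i then U (i div 2) else V (i div 2))" for i :: nat
    have "S \<union> T \<subseteq> (\<Union>i. W i)"
    proof
      fix x assume "x \<in> S \<union> T"
      then consider i where "x \<in> U i" | i where "x \<in> V i" using U V by blast
      then show "x \<in> (\<Union>i. W i)"
      proof cases
        case (1 i) then have "x \<in> W (2 * i)" by (simp add: W_def)
        then show ?thesis by blast
      next
        case (2 i) then have "x \<in> W (2 * i + 1)" by (simp add: W_def)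
        then show ?thesis by blast
      qed
    qed
    then have "W \<in> ?C (S \<union> T)" using U V by (auto simp: W_def)
    then have "hausdorff_premeasure d \<delta> (S \<union> T) \<le> (\<Sum>i. ?c (W i))"
      unfolding hausdorff_premeasure_def by (rule INF_lower)
    also have "(\<lambda>i. ?c (W i)) = (\<lambda>n. if even n then ?c (U (n div 2)) else ?c (V (n div 2)))"
      by (auto simp: W_def)
    also have "(\<Sum>i. \<dots> i) \<le> (\<Sum>i. ?c (U i)) + (\<Sum>i. ?c (V i))"
      by (rule suminf_interleave_le)
    finally show ?thesis .
  qed
  show ?thesis
  proof (rule ennreal_le_epsilon)
    fix e :: real
    assume fin: "hausdorff_premeasure d \<delta> S + hausdorff_premeasure d \<delta> T < top" and "0 < e"
    \<comment> \<open>Finiteness makes the addition of \<open>e / 2\<close> a strict increase, so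
      the infimum is undercut by an actual cover.\<close>
    have near: "\<exists>U\<in>?C S. (\<Sum>i. ?c (U i)) < hausdorff_premeasure d \<delta> S + ennreal (e / 2)"
      if "hausdorff_premeasure d \<delta> S < top" for S
    proof -
      have "hausdorff_premeasure d \<delta> S < hausdorff_premeasure d \<delta> S + ennreal (e / 2)"
        using that \<open>0 < e\<close> by (cases "hausdorff_premeasure d \<delta> S")
          (auto simp: ennreal_less_iff simp flip: ennreal_plus)
      then show ?thesis
        by (subst (asm) hausdorff_premeasure_def) (simp only: INF_less_iff)
    qed
    from near[of S] obtain U where U: "U \<in> ?C S"
        "(\<Sum>i. ?c (U i)) \<le> hausdorff_premeasure d \<delta> S + ennreal (e / 2)"
      using fin by (auto intro: less_imp_le)
    from near[of T] obtain V where V: "V \<in> ?C T"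
        "(\<Sum>i. ?c (V i)) \<le> hausdorff_premeasure d \<delta> T + ennreal (e / 2)"
      using fin by (auto intro: less_imp_le)
    have "ennreal e = ennreal (e / 2) + ennreal (e / 2)"
      using \<open>0 < e\<close> by (simp flip: ennreal_plus)
    then show "hausdorff_premeasure d \<delta> (S \<union> T)
        \<le> hausdorff_premeasure d \<delta> S + hausdorff_premeasure d \<delta> T + ennreal e"
      using *[OF U(1) V(1)] add_mono[OF U(2) V(2)]
      by (simp add: ac_simps)
  qed
qed

lemma hausdorff_premeasure_UN_le:
  assumes "finite I" "\<delta> > 0"
  shows "hausdorff_premeasure d \<delta> (\<Union>i\<in>I. S i) \<le> (\<Sum>i\<in>I. hausdorff_premeasure d \<delta> (S i))"
  using assms(1)
proof induction
  case empty
  then show ?case using assms by simp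
next
  case (insert i I)
  have "hausdorff_premeasure d \<delta> (S i \<union> (\<Union>i\<in>I. S i))
      \<le> hausdorff_premeasure d \<delta> (S i) + hausdorff_premeasure d \<delta> (\<Union>i\<in>I. S i)"
    by (rule hausdorff_premeasure_Un_le)
  also have "\<dots> \<le> hausdorff_premeasure d \<delta> (S i) + (\<Sum>i\<in>I. hausdorff_premeasure d \<delta> (S i))"
    using insert by (intro add_left_mono)
  finally show ?case using insert by simp
qed

lemma hausdorff_premeasure_le_measure:
  "\<delta> > 0 \<Longrightarrow> hausdorff_premeasure d \<delta> S \<le> hausdorff_measure d S"
  unfolding hausdorff_measure_def by (rule SUP_upper) auto

lemma hausdorff_measure_mono:
  "S \<subseteq> T \<Longrightarrow> hausdorff_measure d S \<le> hausdorff_measure d T"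
  unfolding hausdorff_measure_def by (intro SUP_mono' hausdorff_premeasure_mono)

lemma hausdorff_measure_UN_le:
  assumes "finite I"
  shows "hausdorff_measure d (\<Union>i\<in>I. S i) \<le> (\<Sum>i\<in>I. hausdorff_measure d (S i))"
  unfolding hausdorff_measure_def[of d "\<Union>i\<in>I. S i"]
proof (rule SUP_least)
  fix \<delta> :: real assume "\<delta> \<in> {0<..}"
  then have "\<delta> > 0" by simp
  then have "hausdorff_premeasure d \<delta> (\<Union>i\<in>I. S i) \<le> (\<Sum>i\<in>I. hausdorff_premeasure d \<delta> (S i))"
    using assms by (intro hausdorff_premeasure_UN_le)
  also have "\<dots> \<le> (\<Sum>i\<in>I. hausdorff_measure d (S i))"
    using \<open>\<delta> > 0\<close> by (intro sum_mono hausdorff_premeasure_le_measure)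
  finally show "hausdorff_premeasure d \<delta> (\<Union>i\<in>I. S i) \<le> (\<Sum>i\<in>I. hausdorff_measure d (S i))" .
qed

lemma hausdorff_measure_Un_le:
  "hausdorff_measure d (S \<union> T) \<le> hausdorff_measure d S + hausdorff_measure d T"
  using hausdorff_measure_UN_le[of "{True, False}" d "\<lambda>b. if b then S else T"]
  by (simp add: Un_commute add.commute)

text \<open>The images of a cover of mesh \<open>\<delta> / r\<close> form a cover of mesh \<delta>,
  and each content grows by a factor of at most \<open>r ^ d\<close>.\<close>

lemma hausdorff_measure_lipschitz_image_le:
  assumes "r > 0" and f: "\<And>x y. dist (f x) (f y) \<le> r * dist x y"
  shows "hausdorff_measure d (f ` S) \<le> ennreal (r ^ d) * hausdorff_measure d S"
  unfolding hausdorff_measure_def[of d "f ` S"]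
proof (rule SUP_least)
  fix \<delta> :: real assume "\<delta> \<in> {0<..}"
  then have \<delta>: "\<delta> > 0" by simp
  let ?c = "\<lambda>U. if U = {} then 0
      else ennreal (unit_ball_vol (real d) * (diameter U / 2) ^ d)"
  have *: "hausdorff_premeasure d \<delta> (f ` S) \<le> ennreal (r ^ d) * (\<Sum>i. ?c (U i))"
    if U: "S \<subseteq> (\<Union>i. U i)" "\<And>i. bounded (U i)" "\<And>i. diameter (U i) \<le> \<delta> / r"
    for U :: "nat \<Rightarrow> 'a set"
  proof -
    have b: "bounded (f ` U i)" and dm: "diameter (f ` U i) \<le> r * diameter (U i)" for i
    proof -
      have le: "dist (f x) (f y) \<le> r * diameter (U i)" if "x \<in> U i" "y \<in> U i" for x y
        using f[of x y] diameter_bounded_bound[OF U(2) that] \<open>r > 0\<close>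
        by (meson less_imp_le mult_left_mono order_trans)
      then show "bounded (f ` U i)"
        unfolding bounded_two_points by blast
      have "diameter (U i) \<ge> 0" using U(2) by (rule diameter_ge_0)
      then show "diameter (f ` U i) \<le> r * diameter (U i)"
        using \<open>r > 0\<close> le by (simp add: diameter_def[of "f ` U i"]) (auto intro!: cSUP_least)
    qed
    have "diameter (f ` U i) \<le> \<delta>" for i
      using dm[of i] U(3)[of i] \<open>r > 0\<close> by (simp add: field_simps)
    then have "hausdorff_premeasure d \<delta> (f ` S) \<le> (\<Sum>i. ?c (f ` U i))"
      unfolding hausdorff_premeasure_def using b U(1)
      by (intro INF_lower2[where i="\<lambda>i. f ` U i"]) (auto simp: subset_iff, blast)
    also have "\<dots> \<le> (\<Sum>i. ennreal (r ^ d) * ?c (U i))"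
    proof (rule suminf_le)
      fix i
      have "0 \<le> diameter (f ` U i)" using b by (rule diameter_ge_0)
      then have "unit_ball_vol (real d) * (diameter (f ` U i) / 2) ^ d
          \<le> unit_ball_vol (real d) * (r * diameter (U i) / 2) ^ d"
        using dm[of i] by (intro mult_left_mono power_mono) auto
      also have "\<dots> = r ^ d * (unit_ball_vol (real d) * (diameter (U i) / 2) ^ d)"
        by (simp add: power_mult_distrib power_divide)
      finally show "?c (f ` U i) \<le> ennreal (r ^ d) * ?c (U i)"
        using \<open>r > 0\<close> by (auto simp flip: ennreal_mult' intro: ennreal_leI)
    qed auto
    also have "\<dots> = ennreal (r ^ d) * (\<Sum>i. ?c (U i))"
      by (rule ennreal_suminf_cmult)
    finally show ?thesis .
  qed
  let ?C = "{U :: nat \<Rightarrow> 'a set.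
      S \<subseteq> (\<Union>i. U i) \<and> (\<forall>i. bounded (U i) \<and> diameter (U i) \<le> \<delta> / r)}"
  have r: "ennreal (r ^ d) \<noteq> 0" "ennreal (r ^ d) \<noteq> top" using \<open>r > 0\<close> by auto
  \<comment> \<open>Dividing by the constant leaves the infimum alone on the right, so the bound can
    be checked one cover at a time.\<close>
  have div: "hausdorff_premeasure d \<delta> (f ` S) / ennreal (r ^ d) \<le> hausdorff_premeasure d (\<delta> / r) S"
    unfolding hausdorff_premeasure_def[of d "\<delta> / r"]
  proof (rule INF_greatest)
    fix U assume "U \<in> ?C"
    then have "hausdorff_premeasure d \<delta> (f ` S) \<le> ennreal (r ^ d) * (\<Sum>i. ?c (U i))"
      by (intro *) auto
    then show "hausdorff_premeasure d \<delta> (f ` S) / ennreal (r ^ d) \<le> (\<Sum>i. ?c (U i))"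
      using r by (intro divide_le_posI_ennreal) (auto simp: zero_less_iff_neq_zero)
  qed
  have "hausdorff_premeasure d \<delta> (f ` S)
      = ennreal (r ^ d) * (hausdorff_premeasure d \<delta> (f ` S) / ennreal (r ^ d))"
    using r by (metis ennreal_times_divide mult_divide_eq_ennreal mult.commute)
  also have "\<dots> \<le> ennreal (r ^ d) * hausdorff_premeasure d (\<delta> / r) S"
    by (rule mult_left_mono[OF div]) simp
  also have "\<dots> \<le> ennreal (r ^ d) * hausdorff_measure d S"
    using \<delta> \<open>r > 0\<close> by (intro mult_left_mono hausdorff_premeasure_le_measure) auto
  finally show "hausdorff_premeasure d \<delta> (f ` S) \<le> ennreal (r ^ d) * hausdorff_measure d S" .
qed

subsection \<open>Convex sets in a coordinate hyperplane\<close>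

text \<open>The vector \<open>1 - axis k 1\<close> is 0 at \<open>k\<close> and 1 elsewhere: a cube
  of codimension one with side \<open>s\<close> and lowest corner \<open>a\<close>.\<close>

definition face :: "'n \<Rightarrow> real \<Rightarrow> real^'n \<Rightarrow> (real^'n::finite) set" where
  "face k s a = cbox a (a + s *\<^sub>R (1 - axis k 1))"

lemma mem_face:
  "x \<in> face k s a \<longleftrightarrow> x $ k = a $ k \<and> (\<forall>i. i \<noteq> k \<longrightarrow> a $ i \<le> x $ i \<and> x $ i \<le> a $ i + s)"
  by (auto simp: face_def mem_box_cart axis_def order_antisym split: if_splits)

lemma measure_lebesgue_cbox_cart:
  fixes a b :: "real^'n"
  assumes "\<And>i. a $ i \<le> b $ i"
  shows "measure lebesgue (cbox a b) = (\<Prod>i\<in>UNIV. b $ i - a $ i)"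
proof -
  have "cbox a b \<noteq> {}" using assms by (auto simp: interval_ne_empty_cart)
  then show ?thesis by (simp add: content_cbox_cart)
qed

lemma face_subset_image: "s > 0 \<Longrightarrow> face k s a \<subseteq> (\<lambda>x. a + s *\<^sub>R x) ` face k 1 0"
  by (rule subsetI, rule_tac x="(1 / s) *\<^sub>R (x - a)" in image_eqI) (auto simp: mem_face field_simps)

lemma compact_face [simp]: "compact (face k s a)"
  by (simp add: face_def)

text \<open>The l1 norm gives a crude constant, which is enough for showing that the measure of the
  unit face is finite.\<close>

lemma diameter_face_le:
  assumes "s > 0"
  shows "diameter (face k s (a :: real^'n)) \<le> s * real CARD('n)"
proof (rule diameter_le)
  fix x y assume xy: "x \<in> face k s a" "y \<in> face k s a"
  have "\<bar>(x - y) $ i\<bar> \<le> s" for i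
    using xy assms by (cases "i = k") (auto simp: mem_face abs_le_iff; smt)+
  then have "(\<Sum>i\<in>UNIV. \<bar>(x - y) $ i\<bar>) \<le> (\<Sum>i\<in>(UNIV :: 'n set). s)"
    by (intro sum_mono)
  with norm_le_l1_cart[of "x - y"] show "norm (x - y) \<le> s * real CARD('n)"
    by (simp add: mult.commute)
qed (use assms in auto)

text \<open>The sum is the prism of height 1 over \<open>S\<close>. Its Lebesgue measure serves as
  the volume of \<open>S\<close> within the hyperplane, so no measure on the hyperplane itself is
  introduced.\<close>

lemma mem_plus_segment_axis:
  assumes "S \<subseteq> {x. x $ k = 0}"
  shows "x \<in> S + closed_segment 0 (axis k 1) \<longleftrightarrow> x - (x $ k) *\<^sub>R axis k 1 \<in> S \<and> 0 \<le> x $ k \<and> x $ k \<le> 1"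
proof
  assume "x \<in> S + closed_segment 0 (axis k 1)"
  then obtain s t where st: "s \<in> S" "x = s + t *\<^sub>R axis k 1" "0 \<le> t" "t \<le> 1"
    by (auto simp: set_plus_def in_segment)
  moreover have "x $ k = t" using st assms by auto
  ultimately show "x - (x $ k) *\<^sub>R axis k 1 \<in> S \<and> 0 \<le> x $ k \<and> x $ k \<le> 1" by simp
next
  assume "x - (x $ k) *\<^sub>R axis k 1 \<in> S \<and> 0 \<le> x $ k \<and> x $ k \<le> 1"
  moreover have "x = (x - (x $ k) *\<^sub>R axis k 1) + (x $ k) *\<^sub>R axis k 1" by simp
  ultimately show "x \<in> S + closed_segment 0 (axis k 1)"
    by (metis (mono_tags, lifting) closed_segment_def diff_zero in_segment(1) scaleR_zero_right
        add_0 set_plus_intro)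
qed

lemma compact_set_plus:
  fixes S T :: "'a::real_normed_vector set"
  shows "compact S \<Longrightarrow> compact T \<Longrightarrow> compact (S + T)"
  using compact_sums[of S T] by (simp add: set_plus_def conj_commute) (smt (verit) Collect_cong)

lemma prod_axis_slab: "(\<Prod>i\<in>(UNIV :: 'n::finite set). if i = k then 1 else s) = s ^ (CARD('n) - 1)" for s :: real
  by (simp add: prod.If_cases Compl_eq_Diff_UNIV card_Diff_singleton)

text \<open>Round the points of \<open>S\<close> down to the grid of mesh \<delta>. The prisms of
  height 1 over the occupied grid cells are disjoint and lie in \<open>V\<close>, so the volume of
  \<open>V\<close> bounds their number.\<close>

lemma grid_cover:
  fixes S V :: "(real^'n) set"
  assumes "\<delta> > 0" and S: "S \<subseteq> {x. x $ k = 0}" and V: "V \<in> lmeasurable"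
    and near: "\<And>s x. s \<in> S \<Longrightarrow> (\<And>i. i \<noteq> k \<Longrightarrow> \<bar>x $ i - s $ i\<bar> \<le> \<delta>) \<Longrightarrow> 0 \<le> x $ k \<Longrightarrow> x $ k \<le> 1 \<Longrightarrow> x \<in> V"
  obtains F where "finite F" "S \<subseteq> (\<Union>z\<in>F. face k \<delta> z)"
    "real (card F) * \<delta> ^ (CARD('n) - 1) \<le> measure lebesgue V"
proof -
  let ?d = "CARD('n) - 1"
  define g :: "real^'n \<Rightarrow> real^'n"
    where "g x = (\<chi> i. if i = k then 0 else \<delta> * of_int \<lfloor>x $ i / \<delta>\<rfloor>)" for x
  \<comment> \<open>Open boxes: a point of \<open>b (g s)\<close> determines its grid corner, whence
    disjointness.\<close>
  define b where "b z = box z (z + \<delta> *\<^sub>R (1 - axis k 1) + axis k 1)" for z :: "real^'n"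
  have fl: "\<delta> * of_int \<lfloor>t / \<delta>\<rfloor> \<le> t" "t < \<delta> * of_int \<lfloor>t / \<delta>\<rfloor> + \<delta>" for t
    using \<open>\<delta> > 0\<close> floor_divide_lower[of \<delta> t] floor_divide_upper[of \<delta> t] by (auto simp: algebra_simps)
  have mem_b: "x \<in> b z \<longleftrightarrow> z $ k < x $ k \<and> x $ k < z $ k + 1 \<and> (\<forall>i. i \<noteq> k \<longrightarrow> z $ i < x $ i \<and> x $ i < z $ i + \<delta>)" for x z
    by (auto simp: b_def mem_box_cart axis_def)
  have gb: "g x = g s" if "x \<in> b (g s)" for x s
  proof -
    have "\<lfloor>x $ i / \<delta>\<rfloor> = \<lfloor>s $ i / \<delta>\<rfloor>" if "i \<noteq> k" for i
    proof (rule floor_unique)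
      have "\<delta> * of_int \<lfloor>s $ i / \<delta>\<rfloor> < x $ i" "x $ i < \<delta> * of_int \<lfloor>s $ i / \<delta>\<rfloor> + \<delta>"
        using \<open>x \<in> b (g s)\<close> that by (auto simp: mem_b g_def)
      then show "of_int \<lfloor>s $ i / \<delta>\<rfloor> \<le> x $ i / \<delta>" "x $ i / \<delta> < of_int \<lfloor>s $ i / \<delta>\<rfloor> + 1"
        using \<open>\<delta> > 0\<close> by (auto simp: field_simps)
    qed
    then show ?thesis by (simp add: g_def vec_eq_iff)
  qed
  have bV: "b (g s) \<subseteq> V" if "s \<in> S" for s
  proof
    fix x assume x: "x \<in> b (g s)"
    show "x \<in> V"
    proof (rule near[OF \<open>s \<in> S\<close>])
      show "\<bar>x $ i - s $ i\<bar> \<le> \<delta>" if "i \<noteq> k" for i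
        using x that fl[of "s $ i"] by (auto simp: mem_b g_def abs_le_iff; smt)
    qed (use x in \<open>auto simp: mem_b g_def\<close>)
  qed
  have vol_b: "measure lebesgue (b z) = \<delta> ^ ?d" for z
  proof -
    let ?w = "z + \<delta> *\<^sub>R (1 - axis k 1) + axis k 1"
    have le: "z $ i \<le> ?w $ i" for i using \<open>\<delta> > 0\<close> by (auto simp: axis_def)
    have "measure lebesgue (b z) = measure lebesgue (cbox z ?w)"
      using le by (simp add: b_def measure_lborel_box_eq measure_lborel_cbox_eq)
    also have "\<dots> = (\<Prod>i\<in>UNIV. ?w $ i - z $ i)"
      using le by (rule measure_lebesgue_cbox_cart)
    also have "\<dots> = (\<Prod>i\<in>UNIV. if i = k then 1 else \<delta>)"
      by (intro prod.cong) (auto simp: axis_def)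
    finally show ?thesis by (simp add: prod_axis_slab)
  qed
  have b_fin: "b z \<in> sets borel" "emeasure lborel (b z) \<noteq> top" for z
    by (simp_all add: b_def emeasure_lborel_box_eq)
  have card_le: "real (card G) * \<delta> ^ ?d \<le> measure lebesgue V" if G: "G \<subseteq> g ` S" "finite G" for G
  proof -
    have "disjoint_family_on b G"
      unfolding disjoint_family_on_def using G gb by (auto simp: subset_iff image_iff) metis
    then have "measure lebesgue (\<Union>z\<in>G. b z) = (\<Sum>z\<in>G. measure lebesgue (b z))"
      using G by (intro measure_finite_Union) (simp_all add: b_fin image_subset_iff)
    also have "\<dots> = real (card G) * \<delta> ^ ?d" by (simp add: vol_b)
    finally have "real (card G) * \<delta> ^ ?d = measure lebesgue (\<Union>z\<in>G. b z)" ..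
    also have "\<dots> \<le> measure lebesgue V"
      using G bV by (intro measure_mono_fmeasurable V) (auto simp: b_def)
    finally show ?thesis .
  qed
  \<comment> \<open>A bound common to all finite sets of corners shows that the set of all corners
    is finite.\<close>
  have "card G \<le> nat \<lfloor>measure lebesgue V / \<delta> ^ ?d\<rfloor>" if "G \<subseteq> g ` S" "finite G" for G
    using card_le[OF that] \<open>\<delta> > 0\<close> by (simp add: le_nat_floor field_simps)
  then have fin: "finite (g ` S)"
    using finite_if_finite_subsets_card_bdd by blast
  show ?thesis
  proof
    show "S \<subseteq> (\<Union>z\<in>g ` S. face k \<delta> z)"
    proof
      fix s assume s: "s \<in> S"
      then have "s \<in> face k \<delta> (g s)"
        using S fl by (auto simp: mem_face g_def less_imp_le)
      then show "s \<in> (\<Union>z\<in>g ` S. face k \<delta> z)" using s by blast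
    qed
  qed (use fin card_le in auto)
qed

section \<open>The measure of the unit face is finite and positive\<close>

text \<open>A grid of mesh \<open>t\<close> uses at most a constant times \<open>t ^ - d\<close>
  cells, each of content at most a constant times \<open>t ^ d\<close>, where
  \<open>d = CARD('n) - 1\<close>; the resulting bound is the same for all \<delta>.\<close>

lemma hausdorff_measure_unit_face_finite:
  "hausdorff_measure (CARD('n) - 1) (face k 1 (0 :: real^'n)) < \<infinity>"
proof -
  let ?n = "real CARD('n)" and ?d = "CARD('n) - 1"
  define C where "C = 3 ^ CARD('n) * (unit_ball_vol (real ?d) * (?n / 2) ^ ?d)"
  \<comment> \<open>Large enough to hold every prism over a grid cell of mesh at most 1 that meets
    the unit face.\<close>
  let ?V = "cbox (- 1) 2 :: (real^'n) set"
  have V: "measure lebesgue ?V = 3 ^ CARD('n)"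
    by (subst measure_lebesgue_cbox_cart) auto
  have "hausdorff_premeasure ?d \<delta> (face k 1 (0 :: real^'n)) \<le> ennreal C" if "\<delta> > 0" for \<delta>
  proof -
    \<comment> \<open>The bound 1 keeps the prisms inside \<open>?V\<close>; the bound
      \<open>\<delta> / ?n\<close> makes the diameters of the cells at most \<delta>.\<close>
    define t where "t = min 1 (\<delta> / ?n)"
    have t: "0 < t" "t \<le> 1" "t * ?n \<le> \<delta>"
      using that by (auto simp: t_def min_def field_simps)
    obtain F where F: "finite F" "face k 1 (0 :: real^'n) \<subseteq> (\<Union>z\<in>F. face k t z)"
      and card: "real (card F) * t ^ ?d \<le> measure lebesgue ?V"
    proof (rule grid_cover[OF t(1), of "face k 1 0" k ?V])
      fix s x :: "real^'n"
      assume s: "s \<in> face k 1 0" and x: "\<And>i. i \<noteq> k \<Longrightarrow> \<bar>x $ i - s $ i\<bar> \<le> t" "0 \<le> x $ k" "x $ k \<le> 1"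
      have "- 1 \<le> x $ i \<and> x $ i \<le> 2" for i
        using s x(2,3) x(1)[of i] t by (cases "i = k") (auto simp: mem_face abs_le_iff; smt)+
      then show "x \<in> ?V" by (simp add: mem_box_cart)
    qed (auto simp: mem_face)
    have "hausdorff_premeasure ?d \<delta> (face k t z) \<le> ennreal (unit_ball_vol (real ?d) * (t * ?n / 2) ^ ?d)" for z
    proof -
      have dm: "diameter (face k t z) \<le> t * ?n" "0 \<le> diameter (face k t z)"
        using t by (auto intro!: diameter_face_le diameter_ge_0 compact_imp_bounded)
      have "hausdorff_premeasure ?d \<delta> (face k t z) \<le> ennreal (unit_ball_vol (real ?d) * (diameter (face k t z) / 2) ^ ?d)"
        using dm t that by (intro hausdorff_premeasure_le_content) (auto intro: compact_imp_bounded)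
      also have "\<dots> \<le> ennreal (unit_ball_vol (real ?d) * (t * ?n / 2) ^ ?d)"
        using dm by (intro ennreal_leI mult_left_mono power_mono) auto
      finally show ?thesis .
    qed
    then have "(\<Sum>z\<in>F. hausdorff_premeasure ?d \<delta> (face k t z))
        \<le> (\<Sum>z\<in>F. ennreal (unit_ball_vol (real ?d) * (t * ?n / 2) ^ ?d))"
      by (intro sum_mono)
    also have "\<dots> = ennreal (real (card F) * t ^ ?d * (unit_ball_vol (real ?d) * (?n / 2) ^ ?d))"
      using t by (simp add: ennreal_of_nat_eq_real_of_nat power_mult_distrib power_divide mult_ac flip: ennreal_mult)
    also have "\<dots> \<le> ennreal C"
      using card unfolding C_def V by (intro ennreal_leI mult_right_mono) auto
    finally have "(\<Sum>z\<in>F. hausdorff_premeasure ?d \<delta> (face k t z)) \<le> ennreal C" .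
    with hausdorff_premeasure_mono[OF F(2), of ?d \<delta>] hausdorff_premeasure_UN_le[OF F(1) that, of ?d "face k t"]
    show ?thesis by (meson order_trans)
  qed
  then have "hausdorff_measure ?d (face k 1 (0 :: real^'n)) \<le> ennreal C"
    unfolding hausdorff_measure_def by (intro SUP_least) auto
  then show ?thesis by (metis ennreal_less_top infinity_ennreal_def order_le_less_trans)
qed

text \<open>A set of diameter \<open>r\<close> lies in a cube of side \<open>2 r\<close>, so every cover of the unit
  face gives a cover of the unit cube by boxes of base \<open>2 r\<close> and height 1.\<close>

lemma hausdorff_measure_unit_face_pos:
  "hausdorff_measure (CARD('n) - 1) (face k 1 (0 :: real^'n)) > 0"
proof -
  let ?d = "CARD('n) - 1"
  define c where "c = unit_ball_vol (real ?d)"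
  have "c > 0" by (simp add: c_def)
  \<comment> \<open>The ratio of the box volume \<open>(2 * r) ^ ?d\<close> to the content
    \<open>c * (r / 2) ^ ?d\<close> of a set of diameter \<open>r\<close>.\<close>
  define K where "K = 4 ^ ?d / c"
  have "K > 0" using \<open>c > 0\<close> by (simp add: K_def)
  have cover: "1 \<le> ennreal K * (\<Sum>i. if U i = {} then 0 else ennreal (c * (diameter (U i) / 2) ^ ?d))"
    if U: "face k 1 (0 :: real^'n) \<subseteq> (\<Union>i. U i)" "\<And>i. bounded (U i)" for U :: "nat \<Rightarrow> (real^'n) set"
  proof -
    define r where "r i = diameter (U i)" for i
    define p where "p i = (SOME x. x \<in> U i)" for i
    \<comment> \<open>Centred at an arbitrary point of \<open>U i\<close> in all directions except
      \<open>k\<close>, where the box spans the unit interval.\<close>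
    define B where "B i = (if U i = {} then {} else
        cbox (\<chi> j. if j = k then 0 else p i $ j - r i) (\<chi> j. if j = k then 1 else p i $ j + r i))" for i
    have r: "r i \<ge> 0" for i using U(2) by (simp add: r_def diameter_ge_0)
    have vol: "emeasure lebesgue (B i) = ennreal ((2 * r i) ^ ?d)" if "U i \<noteq> {}" for i
    proof -
      have "measure lebesgue (B i) = (\<Prod>j\<in>UNIV. if j = k then 1 else 2 * r i)"
        using that r[of i] by (simp only: B_def if_False, subst measure_lebesgue_cbox_cart)
          (simp, rule prod.cong, simp_all)
      then show ?thesis
        using that by (subst emeasure_eq_ennreal_measure) (auto simp: B_def prod_axis_slab emeasure_lborel_cbox_eq)
    qed
    have B_sets: "B i \<in> sets lebesgue" for i
      by (simp add: B_def)
    have "cbox 0 1 \<subseteq> (\<Union>i. B i)"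
    proof
      fix x :: "real^'n" assume x: "x \<in> cbox 0 1"
      have "x - (x $ k) *\<^sub>R axis k 1 \<in> face k 1 0"
        using x by (auto simp: mem_face mem_box_cart axis_def)
      then obtain i where i: "x - (x $ k) *\<^sub>R axis k 1 \<in> U i" using U(1) by blast
      then have "p i \<in> U i" unfolding p_def by (metis someI)
      have "\<bar>x $ j - p i $ j\<bar> \<le> r i" if "j \<noteq> k" for j
      proof -
        have "\<bar>(x - (x $ k) *\<^sub>R axis k 1 - p i) $ j\<bar> \<le> dist (x - (x $ k) *\<^sub>R axis k 1) (p i)"
          unfolding dist_norm by (rule component_le_norm_cart)
        also have "\<dots> \<le> r i"
          unfolding r_def using i \<open>p i \<in> U i\<close> U(2) by (intro diameter_bounded_bound)
        finally show ?thesis using that by (simp add: axis_def)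
      qed
      then have "x \<in> B i"
        using i x by (auto simp: B_def mem_box_cart abs_le_iff algebra_simps; smt)
      then show "x \<in> (\<Union>i. B i)" by blast
    qed
    moreover have "emeasure lebesgue (cbox 0 (1 :: real^'n)) = 1"
      by (subst emeasure_eq_ennreal_measure)
        (auto simp: emeasure_lborel_cbox_eq measure_lebesgue_cbox_cart simp del: measure_completion)
    ultimately have "1 \<le> emeasure lebesgue (\<Union>i. B i)"
      using emeasure_mono[of "cbox 0 1" "\<Union>i. B i" lebesgue] B_sets by (simp add: sets.countable_UN')
    moreover have "emeasure lebesgue (\<Union>i. B i) \<le> (\<Sum>i. emeasure lebesgue (B i))"
      by (rule emeasure_subadditive_countably, rule image_subsetI, rule B_sets)
    moreover have "(\<Sum>i. emeasure lebesgue (B i)) = (\<Sum>i. ennreal K * (if U i = {} then 0 else ennreal (c * (r i / 2) ^ ?d)))"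
    proof (intro suminf_cong)
      fix i
      have "(2 * r i) ^ ?d = K * (c * (r i / 2) ^ ?d)"
      proof -
        have "(2 * r i) ^ ?d = (4 * (r i / 2)) ^ ?d" by simp
        also have "\<dots> = 4 ^ ?d * (r i / 2) ^ ?d" by (rule power_mult_distrib)
        also have "\<dots> = K * (c * (r i / 2) ^ ?d)" unfolding K_def using \<open>c > 0\<close> by simp
        finally show ?thesis .
      qed
      then show "emeasure lebesgue (B i) = ennreal K * (if U i = {} then 0 else ennreal (c * (r i / 2) ^ ?d))"
        using vol[of i] \<open>K > 0\<close> by (auto simp: B_def ennreal_mult')
    qed
    ultimately have "1 \<le> (\<Sum>i. ennreal K * (if U i = {} then 0 else ennreal (c * (r i / 2) ^ ?d)))"
      by (metis order_trans)
    then show ?thesis by (simp only: ennreal_suminf_cmult r_def)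
  qed
  have *: "ennreal (1 / K) \<le> (\<Sum>i. if U i = {} then 0 else ennreal (c * (diameter (U i) / 2) ^ ?d))"
    if "face k 1 (0 :: real^'n) \<subseteq> (\<Union>i. U i)" "\<And>i. bounded (U i)" for U :: "nat \<Rightarrow> (real^'n) set"
  proof -
    have "1 / ennreal K \<le> (\<Sum>i. if U i = {} then 0 else ennreal (c * (diameter (U i) / 2) ^ ?d))"
      using \<open>K > 0\<close> by (intro divide_le_posI_ennreal cover that) simp_all
    then show ?thesis using \<open>K > 0\<close> by (simp add: divide_ennreal flip: ennreal_1)
  qed
  have "0 < ennreal (1 / K)" using \<open>K > 0\<close> by simp
  also have "\<dots> \<le> hausdorff_premeasure ?d 1 (face k 1 (0 :: real^'n))"
    unfolding hausdorff_premeasure_def c_def[symmetric] by (rule INF_greatest) (auto intro!: *)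
  also have "\<dots> \<le> hausdorff_measure ?d (face k 1 (0 :: real^'n))"
    by (rule hausdorff_premeasure_le_measure) simp
  finally show ?thesis .
qed

section \<open>Hausdorff measure in a hyperplane as the volume of a prism\<close>

lemma hausdorff_measure_face_le:
  assumes "s > 0"
  shows "hausdorff_measure d (face k s a) \<le> ennreal (s ^ d) * hausdorff_measure d (face k 1 0)"
proof -
  have "hausdorff_measure d (face k s a) \<le> hausdorff_measure d ((\<lambda>x. a + s *\<^sub>R x) ` face k 1 0)"
    by (rule hausdorff_measure_mono[OF face_subset_image[OF assms]])
  also have "\<dots> \<le> ennreal (s ^ d) * hausdorff_measure d (face k 1 0)"
    using assms by (intro hausdorff_measure_lipschitz_image_le)
      (auto simp: dist_norm simp flip: scaleR_diff_right)
  finally show ?thesis .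
qed

text \<open>The inverse similarity is Lipschitz with constant \<open>1 / s\<close>; with the upper
  bound, the measure of a cube scales exactly like \<open>s ^ d\<close>.\<close>

lemma hausdorff_measure_face_ge:
  assumes "s > 0"
  shows "ennreal (s ^ d) * hausdorff_measure d (face k 1 0) \<le> hausdorff_measure d (face k s a)"
proof -
  let ?f = "\<lambda>x. (1 / s) *\<^sub>R (x - a)"
  have "face k 1 0 \<subseteq> ?f ` face k s a"
    by (rule subsetI, rule_tac x="a + s *\<^sub>R x" in image_eqI) (use assms in \<open>auto simp: mem_face\<close>)
  then have "hausdorff_measure d (face k 1 0) \<le> hausdorff_measure d (?f ` face k s a)"
    by (rule hausdorff_measure_mono)
  also have "\<dots> \<le> ennreal ((1 / s) ^ d) * hausdorff_measure d (face k s a)"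
    using assms by (intro hausdorff_measure_lipschitz_image_le)
      (auto simp: dist_norm abs_if simp flip: scaleR_diff_right divide_inverse)
  finally have "ennreal (s ^ d) * hausdorff_measure d (face k 1 0)
      \<le> ennreal (s ^ d) * (ennreal ((1 / s) ^ d) * hausdorff_measure d (face k s a))"
    by (rule mult_left_mono) simp
  also have "\<dots> = ennreal (s ^ d * (1 / s) ^ d) * hausdorff_measure d (face k s a)"
    using assms by (simp add: ennreal_mult mult.assoc)
  also have "s ^ d * (1 / s) ^ d = 1"
    using assms by (simp flip: power_mult_distrib)
  finally show ?thesis by simp
qed

text \<open>An open set slightly larger than the prism over \<open>S\<close> bounds the number of
  small grid cubes covering \<open>S\<close>. The constant \<open>h\<close> is never evaluated: it
  enters all three ratios of the theorem as the same factor.\<close>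

lemma hausdorff_measure_le_volume:
  fixes S :: "(real^'n) set"
  assumes S: "compact S" "S \<subseteq> {x. x $ k = 0}" and "h > 0"
    and h: "hausdorff_measure (CARD('n) - 1) (face k 1 (0 :: real^'n)) = ennreal h"
  shows "hausdorff_measure (CARD('n) - 1) S
    \<le> ennreal (h * measure lebesgue (S + closed_segment 0 (axis k 1)))"
proof (rule ennreal_le_epsilon)
  fix e :: real assume "0 < e"
  let ?d = "CARD('n) - 1" and ?K = "S + closed_segment 0 (axis k 1)"
  have K: "compact ?K" using S by (intro compact_set_plus) auto
  then have Kl: "?K \<in> lmeasurable" by (rule lmeasurable_compact)
  \<comment> \<open>The excess \<open>e / h\<close> becomes \<open>e\<close> after multiplication by
    \<open>h\<close>.\<close>
  obtain V where V: "open V" "?K \<subseteq> V" "V - ?K \<in> lmeasurable" "emeasure lebesgue (V - ?K) < ennreal (e / h)"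
    using sets_lebesgue_outer_open[of ?K "e / h"] Kl \<open>0 < e\<close> \<open>0 < h\<close> by (metis divide_pos_pos fmeasurableD)
  have VK: "V = ?K \<union> (V - ?K)" using V by blast
  have Vl: "V \<in> lmeasurable"
    by (subst VK) (intro fmeasurable.Un Kl V)
  have "measure lebesgue (V - ?K) < e / h"
    using V(3,4) \<open>0 < e\<close> \<open>0 < h\<close> by (simp add: emeasure_eq_measure2 ennreal_less_iff)
  moreover have "measure lebesgue V \<le> measure lebesgue ?K + measure lebesgue (V - ?K)"
    by (subst VK) (intro measure_Un_le fmeasurableD Kl V)
  ultimately have mV: "measure lebesgue V \<le> measure lebesgue ?K + e / h" by simp
  obtain r where r: "r > 0" "(\<Union>x\<in>?K. ball x r) \<subseteq> V"
    using compact_subset_open_imp_ball_epsilon_subset[OF K V(1,2)] by blast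
  \<comment> \<open>Moving each coordinate by at most \<delta> displaces a point by less than
    \<open>r\<close>, by the l1 bound on the norm.\<close>
  define \<delta> where "\<delta> = r / (real CARD('n) + 1)"
  have \<delta>: "\<delta> > 0" "real CARD('n) * \<delta> < r"
    using r by (auto simp: \<delta>_def field_simps)
  obtain F where F: "finite F" "S \<subseteq> (\<Union>z\<in>F. face k \<delta> z)" "real (card F) * \<delta> ^ ?d \<le> measure lebesgue V"
  proof (rule grid_cover[OF \<delta>(1) S(2) Vl])
    fix s x :: "real^'n"
    assume s: "s \<in> S" and x: "\<And>i. i \<noteq> k \<Longrightarrow> \<bar>x $ i - s $ i\<bar> \<le> \<delta>" "0 \<le> x $ k" "x $ k \<le> 1"
    \<comment> \<open>The point of the prism above \<open>s\<close> at the same height as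
      \<open>x\<close>.\<close>
    define p where "p = s + (x $ k) *\<^sub>R axis k 1"
    have "p \<in> ?K"
      using s x S(2) by (subst mem_plus_segment_axis[OF S(2)]) (auto simp: p_def)
    have "\<bar>(x - p) $ i\<bar> \<le> \<delta>" for i
      using x(1)[of i] \<delta>(1) s S(2) by (cases "i = k") (auto simp: p_def axis_def)
    then have "(\<Sum>i\<in>UNIV. \<bar>(x - p) $ i\<bar>) \<le> (\<Sum>i\<in>(UNIV :: 'n set). \<delta>)"
      by (intro sum_mono)
    then have "dist p x < r"
      using norm_le_l1_cart[of "x - p"] \<delta>(2) by (simp add: dist_norm norm_minus_commute)
    then have "x \<in> ball p r" by simp
    then show "x \<in> V" using \<open>p \<in> ?K\<close> r(2) by blast
  qed
  have "hausdorff_measure ?d S \<le> hausdorff_measure ?d (\<Union>z\<in>F. face k \<delta> z)"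
    by (rule hausdorff_measure_mono[OF F(2)])
  also have "\<dots> \<le> (\<Sum>z\<in>F. hausdorff_measure ?d (face k \<delta> z))"
    by (rule hausdorff_measure_UN_le[OF F(1)])
  also have "\<dots> \<le> (\<Sum>z\<in>F. ennreal (\<delta> ^ ?d) * ennreal h)"
    unfolding h[symmetric] by (intro sum_mono hausdorff_measure_face_le \<delta>)
  also have "\<dots> = ennreal (real (card F) * \<delta> ^ ?d * h)"
    using \<delta> \<open>h > 0\<close> by (simp add: ennreal_of_nat_eq_real_of_nat mult_ac flip: ennreal_mult)
  also have "\<dots> \<le> ennreal ((measure lebesgue ?K + e / h) * h)"
    using F(3) mV \<open>h > 0\<close> by (intro ennreal_leI mult_right_mono) auto
  also have "(measure lebesgue ?K + e / h) * h = h * measure lebesgue ?K + e"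
    using \<open>h > 0\<close> by (simp add: field_simps)
  also have "ennreal \<dots> = ennreal (h * measure lebesgue ?K) + ennreal e"
    using \<open>h > 0\<close> \<open>0 < e\<close> by (simp add: ennreal_plus)
  finally show "hausdorff_measure ?d S \<le> ennreal (h * measure lebesgue ?K) + ennreal e" .
qed

lemma axis_nth_other: "i \<noteq> k \<Longrightarrow> axis k x $ i = 0"
  by (simp add: axis_def)

lemma volume_face_plus_segment:
  assumes "s \<ge> 0" "a $ k = 0"
  shows "measure lebesgue (face k s a + closed_segment 0 (axis k 1) :: (real^'n) set) = s ^ (CARD('n) - 1)"
proof -
  let ?w = "a + s *\<^sub>R (1 - axis k 1) + axis k 1"
  have W: "face k s a \<subseteq> {x. x $ k = 0}" using assms by (auto simp: mem_face)
  have "face k s a + closed_segment 0 (axis k 1) = cbox a ?w"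
  proof (rule set_eqI)
    fix x
    have "x \<in> face k s a + closed_segment 0 (axis k 1)
        \<longleftrightarrow> 0 \<le> x $ k \<and> x $ k \<le> 1 \<and> (\<forall>i. i \<noteq> k \<longrightarrow> a $ i \<le> x $ i \<and> x $ i \<le> a $ i + s)"
      using assms by (auto simp: mem_plus_segment_axis[OF W] mem_face axis_nth_other)
    also have "\<dots> \<longleftrightarrow> x \<in> cbox a ?w"
      using assms by (auto simp: mem_box_cart axis_def)
    finally show "x \<in> face k s a + closed_segment 0 (axis k 1) \<longleftrightarrow> x \<in> cbox a ?w" .
  qed
  then have "measure lebesgue (face k s a + closed_segment 0 (axis k 1)) = (\<Prod>i\<in>UNIV. ?w $ i - a $ i)"
    using assms by (simp only:, subst measure_lebesgue_cbox_cart) (auto simp: axis_def)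
  also have "\<dots> = (\<Prod>i\<in>UNIV. if i = k then 1 else s)"
    by (intro prod.cong) (auto simp: axis_def)
  finally show ?thesis by (simp add: prod_axis_slab)
qed

text \<open>The upper bound holds for every compact set; applying it to the complement of \<open>S\<close> in a
  large cube gives the lower bound, because the boundary of a convex set is negligible.\<close>

lemma hausdorff_measure_convex:
  fixes S :: "(real^'n) set"
  assumes S: "compact S" "convex S" "S \<subseteq> {x. x $ k = 0}" and "h > 0"
    and h: "hausdorff_measure (CARD('n) - 1) (face k 1 (0 :: real^'n)) = ennreal h"
  shows "hausdorff_measure (CARD('n) - 1) S
    = ennreal (h * measure lebesgue (S + closed_segment 0 (axis k 1)))"
proof (rule antisym)
  let ?d = "CARD('n) - 1" and ?I = "closed_segment 0 (axis k 1) :: (real^'n) set"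
  show up: "hausdorff_measure ?d S \<le> ennreal (h * measure lebesgue (S + ?I))"
    by (rule hausdorff_measure_le_volume[OF S(1,3) \<open>h > 0\<close> h])
  obtain M where M: "M > 0" "\<And>x. x \<in> S \<Longrightarrow> norm x \<le> M"
    using compact_imp_bounded[OF S(1)] bounded_pos by blast
  \<comment> \<open>\<open>Q\<close> is the cube of side \<open>2 * M\<close> in the hyperplane
    centred at the origin, large enough to contain \<open>S\<close>; the closure in \<open>T\<close>
    restores compactness.\<close>
  define a :: "real^'n" where "a = (\<chi> i. if i = k then 0 else - M)"
  define Q where "Q = face k (2 * M) a"
  define T where "T = closure (Q - S)"
  have QW: "Q \<subseteq> {x. x $ k = 0}" by (auto simp: Q_def mem_face a_def)
  have SQ: "S \<subseteq> Q"
  proof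
    fix x assume x: "x \<in> S"
    then have "\<bar>x $ i\<bar> \<le> M" for i
      using M(2) component_le_norm_cart[of x i] by (meson order_trans)
    then show "x \<in> Q" using x S(3) by (auto simp: Q_def mem_face a_def abs_le_iff) (smt)
  qed
  have TQ: "T \<subseteq> Q" unfolding T_def
    by (rule closure_minimal) (auto simp: Q_def compact_imp_closed)
  then have TW: "T \<subseteq> {x. x $ k = 0}" using QW by blast
  have T: "compact T"
    using bounded_subset[OF compact_imp_bounded[OF compact_face], of "Q - S"]
    by (auto simp: T_def Q_def)
  have disj: "negligible ((S + ?I) \<inter> (T + ?I))"
  proof (rule negligible_subset)
    show "negligible (frontier (S + ?I))"
      using S by (intro negligible_convex_frontier convex_set_plus) auto
    \<comment> \<open>Near the base point of \<open>x\<close> there are points of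
      \<open>Q - S\<close>. Lifted to the height of \<open>x\<close>, they would lie in the prism
      over \<open>S\<close> if \<open>x\<close> were interior to it.\<close>
    have "x \<notin> interior (S + ?I)" if x: "x \<in> T + ?I" for x
    proof
      assume "x \<in> interior (S + ?I)"
      then obtain e where e: "e > 0" "ball x e \<subseteq> S + ?I"
        by (meson mem_interior)
      have "x - (x $ k) *\<^sub>R axis k 1 \<in> closure (Q - S)"
        using x mem_plus_segment_axis[OF TW] by (simp add: T_def)
      then obtain y where y: "y \<in> Q - S" "dist y (x - (x $ k) *\<^sub>R axis k 1) < e"
        using e(1) closure_approachable by blast
      let ?y = "y + (x $ k) *\<^sub>R axis k 1"
      have "?y \<in> ball x e"
        using y(2) by (simp add: dist_norm norm_minus_commute algebra_simps)
      then have "?y \<in> S + ?I" using e(2) by blast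
      then have "?y - (?y $ k) *\<^sub>R axis k 1 \<in> S"
        using mem_plus_segment_axis[OF S(3)] by blast
      moreover have "?y - (?y $ k) *\<^sub>R axis k 1 = y" using y(1) QW by auto
      ultimately show False using y(1) by simp
    qed
    then show "(S + ?I) \<inter> (T + ?I) \<subseteq> frontier (S + ?I)"
      by (auto simp: frontier_def intro: subsetD[OF closure_subset])
  qed
  have meas: "compact (S + ?I)" "compact (T + ?I)" "compact (Q + ?I)"
    using S(1) T by (auto intro!: compact_set_plus simp: Q_def)
  have "measure lebesgue ((S + ?I) \<union> (T + ?I)) = measure lebesgue (S + ?I) + measure lebesgue (T + ?I) + measure lebesgue ({} :: (real^'n) set)"
    using disj meas by (intro measure_Un3_negligible[where U="{}"]) (auto intro: lmeasurable_compact)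
  moreover have "measure lebesgue ((S + ?I) \<union> (T + ?I)) \<le> measure lebesgue (Q + ?I)"
    using meas SQ TQ by (intro measure_mono_fmeasurable lmeasurable_compact Un_least set_plus_mono2)
      (auto intro!: fmeasurableD lmeasurable_compact compact_Un)
  moreover have volQ: "measure lebesgue (Q + ?I) = (2 * M) ^ ?d"
    unfolding Q_def using M by (intro volume_face_plus_segment) (auto simp: a_def)
  ultimately have vol: "measure lebesgue (S + ?I) + measure lebesgue (T + ?I) \<le> (2 * M) ^ ?d"
    by simp
  have "ennreal ((2 * M) ^ ?d * h) = ennreal ((2 * M) ^ ?d) * ennreal h"
    using M \<open>h > 0\<close> by (simp add: ennreal_mult)
  also have "\<dots> \<le> hausdorff_measure ?d Q"
    unfolding Q_def h[symmetric] using M by (intro hausdorff_measure_face_ge) auto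
  also have "\<dots> \<le> hausdorff_measure ?d (S \<union> T)"
    by (rule hausdorff_measure_mono) (use closure_subset[of "Q - S"] in \<open>auto simp: T_def\<close>)
  also have "\<dots> \<le> hausdorff_measure ?d S + hausdorff_measure ?d T"
    by (rule hausdorff_measure_Un_le)
  also have "\<dots> \<le> hausdorff_measure ?d S + ennreal (h * measure lebesgue (T + ?I))"
    by (intro add_left_mono hausdorff_measure_le_volume[OF T TW \<open>h > 0\<close> h])
  finally have le: "ennreal ((2 * M) ^ ?d * h) \<le> hausdorff_measure ?d S + ennreal (h * measure lebesgue (T + ?I))" .
  \<comment> \<open>The upper bound already proved makes the measure finite, so the remaining
    subtraction takes place in the reals.\<close>
  obtain x where x: "hausdorff_measure ?d S = ennreal x" "x \<ge> 0"
    using up by (cases "hausdorff_measure ?d S") (auto simp: top_unique)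
  from le have "(2 * M) ^ ?d * h \<le> x + h * measure lebesgue (T + ?I)"
    using x \<open>h > 0\<close> by (simp flip: ennreal_plus)
  moreover have "h * (measure lebesgue (S + ?I) + measure lebesgue (T + ?I)) \<le> h * (2 * M) ^ ?d"
    using vol \<open>h > 0\<close> by (intro mult_left_mono) auto
  ultimately show "ennreal (h * measure lebesgue (S + ?I)) \<le> hausdorff_measure ?d S"
    unfolding x by (intro ennreal_leI) (simp add: algebra_simps)
qed

subsection \<open>Volumes of linear images\<close>

text \<open>Both sides are multiplicative under composition, so it suffices to treat elementary
  maps: those annihilating a coordinate, diagonal maps, transpositions and shears.\<close>

lemma measure_linear_image_det:
  fixes f :: "real^'n \<Rightarrow> real^'n"
  assumes "linear f" "S \<in> lmeasurable"
  shows "f ` S \<in> lmeasurable \<and> measure lebesgue (f ` S) = \<bar>det (matrix f)\<bar> * measure lebesgue S"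
proof -
  \<comment> \<open>Common frame for transpositions and shears: preserving the volume of boxes
    extends to all measurable sets.\<close>
  have unimodular: "\<forall>S\<in>lmeasurable. f ` S \<in> lmeasurable \<and>
      measure lebesgue (f ` S) = \<bar>det (matrix f)\<bar> * measure lebesgue S"
    if "linear f" "\<bar>det (matrix f)\<bar> = 1"
      "\<And>a b. cbox a b \<noteq> {} \<Longrightarrow> measure lebesgue (f ` cbox a b) = measure lebesgue (cbox a b)"
    for f :: "real^'n \<Rightarrow> real^'n"
  proof
    fix S :: "(real^'n) set" assume S: "S \<in> lmeasurable"
    have "measure lebesgue (f ` cbox a b) = 1 * measure lebesgue (cbox a b)" for a b
      using that(3)[of a b] by (cases "cbox a b = {}") auto
    from measure_linear_sufficient[OF that(1) S this] that(2)
    show "f ` S \<in> lmeasurable \<and>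
        measure lebesgue (f ` S) = \<bar>det (matrix f)\<bar> * measure lebesgue S" by auto
  qed
  have "\<forall>S\<in>lmeasurable. f ` S \<in> lmeasurable \<and>
      measure lebesgue (f ` S) = \<bar>det (matrix f)\<bar> * measure lebesgue S"
  proof (rule induct_linear_elementary[OF \<open>linear f\<close>])
    fix f g :: "real^'n \<Rightarrow> real^'n"
    assume "linear f" "linear g"
      and "\<forall>S\<in>lmeasurable. f ` S \<in> lmeasurable \<and>
        measure lebesgue (f ` S) = \<bar>det (matrix f)\<bar> * measure lebesgue S"
      and "\<forall>S\<in>lmeasurable. g ` S \<in> lmeasurable \<and>
        measure lebesgue (g ` S) = \<bar>det (matrix g)\<bar> * measure lebesgue S"
    moreover have "(f \<circ> g) ` S = f ` g ` S" for S by auto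
    ultimately show "\<forall>S\<in>lmeasurable. (f \<circ> g) ` S \<in> lmeasurable \<and>
        measure lebesgue ((f \<circ> g) ` S) = \<bar>det (matrix (f \<circ> g))\<bar> * measure lebesgue S"
      by (simp only: matrix_compose det_mul abs_mult) simp
  next
    fix f :: "real^'n \<Rightarrow> real^'n" and i assume f: "linear f" "\<And>x. f x $ i = 0"
    have "row i (matrix f) = 0"
      by (simp add: vec_eq_iff row_def matrix_def f)
    then have "det (matrix f) = 0"
      by (rule det_zero_row)
    moreover have "negligible (f ` S)" for S
      by (rule negligible_subset[OF negligible_standard_hyperplane_cart[of i]]) (use f in auto)
    ultimately show "\<forall>S\<in>lmeasurable. f ` S \<in> lmeasurable \<and>
        measure lebesgue (f ` S) = \<bar>det (matrix f)\<bar> * measure lebesgue S"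
      by (simp add: negligible_iff_measure)
  next
    fix c :: "'n \<Rightarrow> real"
    have "det (matrix (\<lambda>x::real^'n. \<chi> i. c i * x $ i)) = prod c UNIV"
      by (subst det_diagonal) (auto simp: matrix_def axis_def)
    then show "\<forall>S\<in>lmeasurable. (\<lambda>x::real^'n. \<chi> i. c i * x $ i) ` S \<in> lmeasurable \<and>
        measure lebesgue ((\<lambda>x. \<chi> i. c i * x $ i) ` S)
          = \<bar>det (matrix (\<lambda>x::real^'n. \<chi> i. c i * x $ i))\<bar> * measure lebesgue S"
      by (simp add: measurable_stretch measure_stretch)
  next
    fix m n :: 'n assume "m \<noteq> n"
    let ?t = "Transposition.transpose m n"
    let ?f = "\<lambda>x::real^'n. \<chi> i. x $ ?t i"
    have lin: "linear ?f"
      by (rule linearI) (auto simp: vec_eq_iff)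
    have inv: "?f (?f x) = x" for x by (simp add: vec_eq_iff)
    \<comment> \<open>A transposition is an involution, so its determinant squares to 1.\<close>
    have "matrix ?f ** matrix ?f = mat 1"
      using matrix_compose[OF lin lin] inv by (simp add: o_def matrix_id_mat_1 flip: id_def)
    then have "det (matrix ?f) * det (matrix ?f) = 1"
      using det_mul[of "matrix ?f" "matrix ?f"] by (simp only: det_I)
    then have "\<bar>det (matrix ?f)\<bar> = 1"
      by (auto simp: square_eq_1_iff)
    moreover have "measure lebesgue (?f ` cbox a b) = measure lebesgue (cbox a b)"
      if "cbox a b \<noteq> {}" for a b
    proof -
      have img: "?f ` cbox a b = cbox (?f a) (?f b)"
      proof (intro subset_antisym subsetI)
        fix x assume "x \<in> cbox (?f a) (?f b)"
        then have "x $ i \<in> {a $ ?t i..b $ ?t i}" for i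
          by (simp add: mem_box_cart)
        from this[of "?t i" for i] have "?f x \<in> cbox a b"
          by (simp add: mem_box_cart)
        then show "x \<in> ?f ` cbox a b"
          by (metis imageI inv)
      qed (auto simp: mem_box_cart)
      have "(\<Prod>i\<in>UNIV. b $ ?t i - a $ ?t i) = (\<Prod>i\<in>UNIV. b $ i - a $ i)"
        by (rule prod.reindex_bij_betw[OF bij_transpose])
      moreover have "cbox (?f a) (?f b) \<noteq> {}"
        using that img by blast
      ultimately show ?thesis
        using that img by (simp add: content_cbox_cart)
    qed
    ultimately show "\<forall>S\<in>lmeasurable. ?f ` S \<in> lmeasurable \<and>
        measure lebesgue (?f ` S) = \<bar>det (matrix ?f)\<bar> * measure lebesgue S"
      using lin by (intro unimodular) auto
  next
    fix m n :: 'n assume mn: "m \<noteq> n"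
    let ?f = "\<lambda>x::real^'n. \<chi> i. if i = m then x $ m + x $ n else x $ i"
    have lin: "linear ?f"
      by (rule linearI) (auto simp: vec_eq_iff algebra_simps)
    have "matrix ?f = (\<chi> i. if i = m then row m (mat 1) + 1 *s row n (mat 1) else row i (mat 1))"
      using mn by (auto simp: vec_eq_iff matrix_def row_def mat_def axis_def)
    then have "\<bar>det (matrix ?f)\<bar> = 1"
      using det_row_operation[OF mn, of "mat 1 :: real^'n^'n" 1] by simp
    moreover have "measure lebesgue (?f ` cbox a b) = measure lebesgue (cbox a b)"
      if "cbox a b \<noteq> {}" for a b
    proof -
      \<comment> \<open>A translation moves the corner to the origin, where the volume of a sheared
        box is known.\<close>
      have box: "cbox a b = (+) a ` cbox 0 (b - a)"
        using cbox_translation[of a 0 "b - a"] by simp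
      have "?f ` cbox a b = (+) (?f a) ` (?f ` cbox 0 (b - a))"
        unfolding box image_image using linear_add[OF lin] by (intro image_cong) auto
      then have "measure lebesgue (?f ` cbox a b) = measure lebesgue (?f ` cbox 0 (b - a))"
        by (simp add: measure_translation)
      also have "\<dots> = measure lebesgue (cbox 0 (b - a))"
        using that box by (intro measure_shear_interval[OF mn]) auto
      also have "\<dots> = measure lebesgue (cbox a b)"
        unfolding box by (simp add: measure_translation)
      finally show ?thesis .
    qed
    ultimately show "\<forall>S\<in>lmeasurable. ?f ` S \<in> lmeasurable \<and>
        measure lebesgue (?f ` S) = \<bar>det (matrix ?f)\<bar> * measure lebesgue S"
      using lin by (intro unimodular) auto
  qed
  then show ?thesis using assms by blast
qed

subsection \<open>Multi-affine functions of multisets\<close>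

text \<open>Vanishing second differences: \<open>V\<close> is affine in the multiplicity of each
  element separately. The multisets will be those of zonotope generators.\<close>

definition multi_affine :: "('a multiset \<Rightarrow> real) \<Rightarrow> bool" where
  "multi_affine V \<longleftrightarrow> (\<forall>x M. V (add_mset x (add_mset x M)) - V (add_mset x M) = V (add_mset x M) - V M)"

definition diff_at :: "'a \<Rightarrow> ('a multiset \<Rightarrow> real) \<Rightarrow> 'a multiset \<Rightarrow> real" where
  "diff_at x V M = V (add_mset x M) - V M"

text \<open>The mixed difference of \<open>V\<close> at the empty multiset in the listed
  directions.\<close>

fun iter_diff :: "('a multiset \<Rightarrow> real) \<Rightarrow> 'a list \<Rightarrow> real" where
  "iter_diff V [] = V {#}"
| "iter_diff V (x # xs) = iter_diff (diff_at x V) xs"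

lemma multi_affine_diff_at: "multi_affine V \<Longrightarrow> multi_affine (diff_at x V)"
  unfolding multi_affine_def diff_at_def
proof (intro allI)
  fix y M assume *: "\<forall>x M. V (add_mset x (add_mset x M)) - V (add_mset x M) = V (add_mset x M) - V M"
  show "V (add_mset x (add_mset y (add_mset y M))) - V (add_mset y (add_mset y M))
      - (V (add_mset x (add_mset y M)) - V (add_mset y M))
    = V (add_mset x (add_mset y M)) - V (add_mset y M) - (V (add_mset x M) - V M)"
    using *[rule_format, of y "add_mset x M"] *[rule_format, of y M]
    by (simp add: add_mset_commute)
qed

text \<open>A discrete Taylor expansion, valid for every \<open>V\<close>: adding \<open>x\<close>
  contributes \<open>diff_at x V\<close>, and both summands are expanded in turn.\<close>

lemma sum_diffs: "V (mset xs) = (\<Sum>S\<leftarrow>subseqs xs. iter_diff V S)"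
proof (induction xs arbitrary: V)
  case (Cons x xs)
  from Cons[of V] Cons[of "diff_at x V"] show ?case
    by (simp add: Let_def diff_at_def[of x V "mset xs"] o_def)
qed simp

text \<open>By affinity two copies of \<open>x\<close> contribute twice the first difference, so
  each element of a sublist brings a factor 2.\<close>

lemma sum_diffs_double:
  assumes "multi_affine V"
  shows "V (mset xs + mset xs) = (\<Sum>S\<leftarrow>subseqs xs. 2 ^ length S * iter_diff V S)"
  using assms
proof (induction xs arbitrary: V)
  case (Cons x xs)
  let ?M = "mset xs + mset xs"
  have "V (mset (x # xs) + mset (x # xs)) = V ?M + 2 * diff_at x V ?M"
    using Cons.prems unfolding multi_affine_def diff_at_def by (simp add: algebra_simps)
  with Cons.IH[OF Cons.prems] Cons.IH[OF multi_affine_diff_at[OF Cons.prems]] show ?case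
    by (simp add: Let_def o_def sum_list_const_mult mult.assoc)
qed simp

text \<open>Isolates the full list among its sublists, so that an expansion can be solved for its
  top term by induction on length.\<close>

lemma subseqs_eq_Cons:
  "\<exists>B. subseqs xs = xs # B \<and> (\<forall>S\<in>set B. length S < length xs)"
proof (induction xs)
  case (Cons x xs)
  then obtain B where B: "subseqs xs = xs # B" "\<forall>S\<in>set B. length S < length xs" by blast
  then have "subseqs (x # xs) = (x # xs) # (map ((#) x) B @ xs # B)" by (simp add: Let_def)
  moreover have "\<forall>S\<in>set (map ((#) x) B @ xs # B). length S < length (x # xs)"
    using B(2) by auto
  ultimately show ?case by blast
qed simp

text \<open>Doubling \<open>xs\<close> multiplies the term of a sublist \<open>S\<close> by \<open>2 ^ length S\<close>, but the whole sum by
  \<open>2 ^ d\<close>; hence only the terms with \<open>length S = d\<close> survive.\<close>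

lemma iter_diff_eq_0:
  assumes aff: "multi_affine V" and hom: "\<And>M. V (M + M) = 2 ^ d * V M"
    and small: "\<And>M. size M < d \<Longrightarrow> V M = 0" and "length xs \<noteq> d"
  shows "iter_diff V xs = 0"
  using assms(4)
proof (induction xs rule: length_induct)
  case (1 xs)
  obtain B where B: "subseqs xs = xs # B" "\<And>S. S \<in> set B \<Longrightarrow> length S < length xs"
    using subseqs_eq_Cons[of xs] by blast
  have B0: "iter_diff V S = 0" if "S \<in> set B" "length S \<noteq> d" for S
    using 1 B(2) that by blast
  show ?case
  proof (cases "length xs < d")
    case True
    then have "iter_diff V S = 0" if "S \<in> set B" for S
      using B(2)[OF that] by (intro B0 that) simp
    then have "(\<Sum>S\<leftarrow>B. iter_diff V S) = (\<Sum>S\<leftarrow>B. 0)"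
      by (intro arg_cong[of _ _ sum_list] map_cong refl)
    then show ?thesis
      using sum_diffs[of V xs] small[of "mset xs"] True B(1) by simp
  next
    case False
    with 1 have "d < length xs" by simp
    have "(\<Sum>S\<leftarrow>subseqs xs. 2 ^ length S * iter_diff V S) = 2 ^ d * (\<Sum>S\<leftarrow>subseqs xs. iter_diff V S)"
      using sum_diffs_double[OF aff, of xs] sum_diffs[of V xs] hom[of "mset xs"] by simp
    \<comment> \<open>Proper sublists of length \<open>d\<close> have equal weights on both sides,
      and all others vanish by induction; only the term of \<open>xs\<close> can tell the two sums
      apart.\<close>
    moreover have "(\<Sum>S\<leftarrow>B. 2 ^ length S * iter_diff V S) = (\<Sum>S\<leftarrow>B. 2 ^ d * iter_diff V S)"
      using B0 by (intro arg_cong[of _ _ sum_list] map_cong refl) (metis mult_zero_right)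
    ultimately have "(2 ^ length xs - 2 ^ d) * iter_diff V xs = 0"
      by (simp add: B(1) sum_list_const_mult left_diff_distrib distrib_left)
    moreover have "(2::real) ^ length xs \<noteq> 2 ^ d"
      using \<open>d < length xs\<close> by simp
    ultimately show ?thesis by simp
  qed
qed

text \<open>Only mixed differences of order \<open>d\<close> survive. Expanding \<open>V\<close> at
  a list of length \<open>d\<close> leaves its top term alone, so that difference is the value of
  \<open>V\<close> there.\<close>

lemma multi_affine_homogeneous_eq:
  assumes aff: "multi_affine V" and hom: "\<And>M. V (M + M) = 2 ^ d * V M"
    and small: "\<And>M. size M < d \<Longrightarrow> V M = 0"
  shows "V (mset xs) = (\<Sum>S\<leftarrow>subseqs xs. if length S = d then V (mset S) else 0)"
proof -
  have zero: "iter_diff V S = 0" if "length S \<noteq> d" for S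
    by (rule iter_diff_eq_0[OF aff, of d]) (simp_all add: hom small that)
  have "iter_diff V S = (if length S = d then V (mset S) else 0)" for S
  proof (cases "length S = d")
    case True
    obtain B where B: "subseqs S = S # B" "\<And>T. T \<in> set B \<Longrightarrow> length T < length S"
      using subseqs_eq_Cons[of S] by blast
    have "iter_diff V T = 0" if "T \<in> set B" for T
      using B(2)[OF that] True by (intro zero) simp
    then have "(\<Sum>S\<leftarrow>B. iter_diff V S) = (\<Sum>S\<leftarrow>B. 0)"
      by (intro arg_cong[of _ _ sum_list] map_cong refl)
    then show ?thesis
      using sum_diffs[of V S] True by (simp add: B(1))
  next
    case False
    with zero show ?thesis by simp
  qed
  then show ?thesis
    using sum_diffs[of V xs] by simp
qed

section \<open>Sums over pairs and triples of list entries\<close>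

text \<open>Recursive equations let the simplifier evaluate the determinant sums on concrete
  generator lists.\<close>

fun pair_sum :: "('a \<Rightarrow> 'a \<Rightarrow> real) \<Rightarrow> 'a list \<Rightarrow> real" where
  "pair_sum f [] = 0"
| "pair_sum f (x # xs) = (\<Sum>y\<leftarrow>xs. f x y) + pair_sum f xs"

fun triple_sum :: "('a \<Rightarrow> 'a \<Rightarrow> 'a \<Rightarrow> real) \<Rightarrow> 'a list \<Rightarrow> real" where
  "triple_sum f [] = 0"
| "triple_sum f (x # xs) = pair_sum (f x) xs + triple_sum f xs"

lemma pair_sum_mult: "pair_sum (\<lambda>x y. c * f x y) xs = c * pair_sum f xs"
  by (induction xs) (simp_all add: sum_list_const_mult distrib_left)

lemma triple_sum_mult: "triple_sum (\<lambda>x y z. c * f x y z) xs = c * triple_sum f xs"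
  by (induction xs) (simp_all add: pair_sum_mult distrib_left)

lemma sum_subseqs_0: "(\<Sum>S\<leftarrow>subseqs xs. if S = [] then c else 0) = (c :: real)"
  by (induction xs) (simp_all add: Let_def o_def)

lemma sum_subseqs_1:
  "(\<Sum>S\<leftarrow>subseqs xs. if length S = Suc 0 then g S else 0) = (\<Sum>x\<leftarrow>xs. g [x] :: real)"
proof (induction xs)
  case (Cons x xs)
  have "(\<lambda>S. if S = [] then g (x # S) else 0) = (\<lambda>S. if S = [] then g [x] else 0)" by auto
  then show ?case using Cons by (simp add: Let_def o_def sum_subseqs_0)
qed simp

lemma sum_subseqs_2:
  "(\<Sum>S\<leftarrow>subseqs xs. if length S = Suc (Suc 0) then g S else 0) = pair_sum (\<lambda>x y. g [x, y]) xs"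
proof (induction xs)
  case (Cons x xs)
  with sum_subseqs_1[of "\<lambda>S. g (x # S)" xs] show ?case
    by (simp add: Let_def o_def)
qed simp

lemma sum_subseqs_3:
  "(\<Sum>S\<leftarrow>subseqs xs. if length S = 3 then g S else 0) = triple_sum (\<lambda>x y z. g [x, y, z]) xs"
  unfolding numeral_3_eq_3
proof (induction xs)
  case (Cons x xs)
  with sum_subseqs_2[of "\<lambda>S. g (x # S)" xs] show ?case
    by (simp add: Let_def o_def)
qed simp

subsection \<open>Volumes of zonotopes\<close>

text \<open>A multiset rather than a set, since \<open>A\<close> and \<open>B\<close> share
  generators and their sum repeats them.\<close>

definition zono :: "'a::real_vector multiset \<Rightarrow> 'a set" where
  "zono M = (\<Sum>x\<in>#M. closed_segment 0 x)"

lemma zono_empty [simp]: "zono {#} = {0}"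
  by (simp add: zono_def)

lemma zono_add_mset [simp]: "zono (add_mset x M) = closed_segment 0 x + zono M"
  by (simp add: zono_def)

lemma zono_union: "zono (M + N) = zono M + zono N"
  by (simp add: zono_def)

lemma compact_zono: "compact (zono (M :: 'a::real_normed_vector multiset))"
  by (induction M) (auto intro!: compact_set_plus)

lemma convex_zono: "convex (zono M)"
  by (induction M) (auto intro!: convex_set_plus)

lemma zero_in_zono: "0 \<in> zono M"
proof (induction M)
  case (add x M)
  then have "0 + 0 \<in> closed_segment 0 x + zono M" by (intro set_plus_intro) auto
  then show ?case by simp
qed simp

lemma zono_subset_subspace: "subspace W \<Longrightarrow> set_mset M \<subseteq> W \<Longrightarrow> zono M \<subseteq> W"
proof (induction M)
  case (add x M)
  then show ?case
    by (auto simp: set_plus_def in_segment subspace_add subspace_scale subset_iff)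
qed (simp add: subspace_0)

lemma linear_image_set_plus: "linear f \<Longrightarrow> f ` (S + T) = f ` S + f ` T"
  by (auto simp: set_plus_def linear_add image_iff) (metis linear_add)+

lemma linear_image_zono:
  assumes "linear f" shows "f ` zono M = zono (image_mset f M)"
proof (induction M)
  case (add x M)
  then show ?case
    using closed_segment_linear_image[OF assms, of 0 x] linear_0[OF assms]
    by (simp add: linear_image_set_plus[OF assms])
qed (simp add: linear_0[OF assms])

text \<open>A segment added to itself is the segment of twice the length, so doubling all
  multiplicities is dilation by 2.\<close>

lemma zono_double: "zono (image_mset (\<lambda>x. 2 *\<^sub>R x) M) = zono (M + M)"
proof (induction M)
  case (add x M)
  have "closed_segment 0 x + closed_segment 0 x = closed_segment 0 (2 *\<^sub>R x)"
  proof (intro subset_antisym subsetI)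
    fix y assume "y \<in> closed_segment 0 (2 *\<^sub>R x)"
    then obtain t where t: "y = t *\<^sub>R (2 *\<^sub>R x)" "0 \<le> t" "t \<le> 1" by (auto simp: in_segment)
    then have "y = t *\<^sub>R x + t *\<^sub>R x" by (simp flip: scaleR_add_left)
    then show "y \<in> closed_segment 0 x + closed_segment 0 x"
      using t by (auto simp: in_segment intro!: set_plus_intro)
  next
    fix y assume "y \<in> closed_segment 0 x + closed_segment 0 x"
    then obtain s t where "y = s *\<^sub>R x + t *\<^sub>R x" "0 \<le> s" "s \<le> 1" "0 \<le> t" "t \<le> 1"
      by (auto simp: in_segment set_plus_def)
    then show "y \<in> closed_segment 0 (2 *\<^sub>R x)"
      by (auto simp: in_segment intro!: exI[of _ "(s + t) / 2"] simp flip: scaleR_add_left)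
  qed
  then have "closed_segment 0 (2 *\<^sub>R x) + (zono M + zono M)
      = closed_segment 0 x + (closed_segment 0 x + (zono M + zono M))"
    by (simp flip: add.assoc)
  with add show ?case by (simp add: zono_union add_ac)
qed simp

lemma zonotope_zono: "zonotope (zono M)"
proof (induction M)
  case empty
  show ?case unfolding zonotope_def
    by (intro exI[of _ 0]) simp
next
  case (add x M)
  then obtain m a b where Z: "zono M = (\<Sum>i<m::nat. closed_segment (a i) (b i))"
    unfolding zonotope_def by blast
  have "(\<Sum>i<Suc m. closed_segment ((a(m := 0)) i) ((b(m := x)) i)) = zono M + closed_segment 0 x"
    unfolding Z by (simp add: sum.lessThan_Suc)
  then show ?case unfolding zonotope_def
    by (metis zono_add_mset add.commute)
qed

lemma zonoid_zono: "zonoid (zono (M :: 'a::real_normed_vector multiset))"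
proof -
  have "hausdorff_dist (zono M) (zono M) = 0"
    using zero_in_zono[of M] by (simp add: hausdorff_dist_def cSUP_const[of "zono M" 0] ex_in_conv[symmetric] exI)
  then show ?thesis
    unfolding zonoid_def using zonotope_zono[of M] zero_in_zono[of M]
    by (auto simp: compact_zono intro!: exI[of _ "\<lambda>_. zono M"])
qed

lemma full_dimensional_convex:
  fixes S :: "'a::euclidean_space set"
  assumes "convex S" "measure lebesgue S > 0"
  shows "full_dimensional S"
proof -
  have "\<not> negligible S" using assms(2) negligible_imp_measure0 by fastforce
  then have "interior S \<noteq> {}" using negligible_convex_interior[OF assms(1)] by blast
  then show ?thesis unfolding full_dimensional_def
    using aff_dim_nonempty_interior by blast
qed

text \<open>Adding a second copy of a segment extends the body by a translate of what the first copy
  added; convexity identifies the overlap.\<close>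

lemma volume_add_segment_affine:
  fixes K :: "'a::euclidean_space set" and x :: 'a
  defines "I \<equiv> closed_segment 0 x"
  assumes K: "compact K" "convex K"
  shows "measure lebesgue (I + (I + K)) - measure lebesgue (I + K)
    = measure lebesgue (I + K) - measure lebesgue K"
proof -
  have mem: "p \<in> I + L \<longleftrightarrow> (\<exists>t q. p = t *\<^sub>R x + q \<and> 0 \<le> t \<and> t \<le> 1 \<and> q \<in> L)" for p L
  proof
    assume "p \<in> I + L"
    then show "\<exists>t q. p = t *\<^sub>R x + q \<and> 0 \<le> t \<and> t \<le> 1 \<and> q \<in> L"
      by (auto simp: I_def set_plus_def in_segment) blast
  next
    assume "\<exists>t q. p = t *\<^sub>R x + q \<and> 0 \<le> t \<and> t \<le> 1 \<and> q \<in> L"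
    then show "p \<in> I + L"
      by (auto simp: I_def in_segment intro!: set_plus_intro)
  qed
  have union: "I + (I + K) = (I + K) \<union> (+) x ` (I + K)"
  proof (intro subset_antisym subsetI)
    fix p assume "p \<in> I + (I + K)"
    then obtain s t q where p: "p = (s + t) *\<^sub>R x + q" "0 \<le> s" "s \<le> 1" "0 \<le> t" "t \<le> 1" "q \<in> K"
      by (auto simp: mem scaleR_add_left add.assoc)
    show "p \<in> (I + K) \<union> (+) x ` (I + K)"
    proof (cases "s + t \<le> 1")
      case True
      then have "p \<in> I + K" using p unfolding mem by (intro exI[of _ "s + t"] exI[of _ q]) auto
      then show ?thesis by blast
    next
      case False
      then have "(s + t - 1) *\<^sub>R x + q \<in> I + K"
        using p unfolding mem by (intro exI[of _ "s + t - 1"] exI[of _ q]) auto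
      moreover have "p = x + ((s + t - 1) *\<^sub>R x + q)" using p by (simp add: algebra_simps)
      ultimately show ?thesis by blast
    qed
  next
    fix p assume "p \<in> (I + K) \<union> (+) x ` (I + K)"
    moreover have "p \<in> I + (I + K)" if "p \<in> I + K"
      unfolding mem[of _ "I + K"] using that by (intro exI[of _ 0] exI[of _ p]) auto
    moreover have "x + q \<in> I + (I + K)" if "q \<in> I + K" for q
      unfolding mem[of _ "I + K"] using that by (intro exI[of _ 1] exI[of _ q]) auto
    ultimately show "p \<in> I + (I + K)" by auto
  qed
  have inter: "(I + K) \<inter> (+) x ` (I + K) = (+) x ` K"
  proof (intro subset_antisym subsetI)
    fix p assume "p \<in> (I + K) \<inter> (+) x ` (I + K)"
    then obtain s q t r where s: "p = s *\<^sub>R x + q" "0 \<le> s" "s \<le> 1" "q \<in> K"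
      and t: "p = x + (t *\<^sub>R x + r)" "0 \<le> t" "t \<le> 1" "r \<in> K"
      by (auto simp: mem)
    have "p - x \<in> K"
    proof (cases "t = 0")
      case True
      then show ?thesis using t by simp
    next
      case False
      \<comment> \<open>\<open>p - x\<close> lies between \<open>q\<close> and \<open>r\<close> on a
        line in direction \<open>x\<close>; this weight cancels the multiples of \<open>x\<close>.
        The case \<open>t = 0\<close> is split off because the denominator may vanish there.\<close>
      let ?w = "t / (t + (1 - s))"
      have w: "0 \<le> ?w" "?w \<le> 1" using False s t by (auto simp: field_simps)
      have "t + (1 - s) > 0" using False s t by auto
      then have w1: "1 - ?w = (1 - s) / (t + (1 - s))" by (simp add: field_simps)
      have q: "q = (p - x) + (1 - s) *\<^sub>R x" and r: "r = (p - x) - t *\<^sub>R x"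
        using s(1) t(1) by (simp_all add: algebra_simps)
      have "w *\<^sub>R q + (1 - w) *\<^sub>R r = (p - x) + (w * (1 - s) - (1 - w) * t) *\<^sub>R x" for w
        unfolding q r by (simp add: algebra_simps)
      from this[of ?w] have "?w *\<^sub>R q + (1 - ?w) *\<^sub>R r
          = (p - x) + (?w * (1 - s) - (1 - ?w) * t) *\<^sub>R x" .
      also have "?w * (1 - s) - (1 - ?w) * t = 0" unfolding w1 by simp
      finally have "p - x = ?w *\<^sub>R q + (1 - ?w) *\<^sub>R r" by simp
      then show ?thesis
        using convexD[OF K(2) s(4) t(4), of ?w "1 - ?w"] w by simp
    qed
    then show "p \<in> (+) x ` K" by (metis add.commute diff_add_cancel imageI)
  next
    fix p assume "p \<in> (+) x ` K"
    then obtain q where q: "p = x + q" "q \<in> K" by blast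
    have "p \<in> I + K" unfolding mem q(1) using q(2) by (intro exI[of _ 1] exI[of _ q]) auto
    moreover have "q \<in> I + K" unfolding mem using q(2) by (intro exI[of _ 0] exI[of _ q]) auto
    ultimately show "p \<in> (I + K) \<inter> (+) x ` (I + K)" using q(1) by blast
  qed
  have "compact (I + K)" "compact ((+) x ` (I + K))"
    using K by (auto intro!: compact_set_plus compact_translation simp: I_def)
  then have "measure lebesgue (I + (I + K)) = measure lebesgue (I + K)
      + measure lebesgue ((+) x ` (I + K)) - measure lebesgue ((+) x ` K)"
    unfolding union inter[symmetric] by (intro measure_Un3 lmeasurable_compact)
  then show ?thesis by (simp add: measure_translation)
qed

section \<open>The determinant formula for volumes\<close>

text \<open>A permutation moving an index outside \<open>{i, j, k}\<close> picks up a zero entry;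
  the six permutations of these three indices give the rule of Sarrus.\<close>

lemma det_three_rows:
  fixes A :: "real^'n^'n"
  assumes ijk: "i \<noteq> j" "i \<noteq> k" "j \<noteq> k"
    and A: "\<And>r s. r \<notin> {i, j, k} \<Longrightarrow> A $ r $ s = (if r = s then 1 else 0)"
  shows "det A = A$i$i * A$j$j * A$k$k + A$i$j * A$j$k * A$k$i + A$i$k * A$j$i * A$k$j
    - A$i$i * A$j$k * A$k$j - A$i$j * A$j$i * A$k$k - A$i$k * A$j$j * A$k$i"
proof -
  let ?T = "{i, j, k}"
  have "det A = (\<Sum>p | p permutes ?T. of_int (sign p) * (\<Prod>r\<in>UNIV. A $ r $ p r))"
    unfolding det_def
  proof (rule sum.mono_neutral_right)
    show "finite {p. p permutes (UNIV :: 'n set)}" by simp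
    show "{p. p permutes ?T} \<subseteq> {p. p permutes UNIV}" by (auto intro: permutes_subset)
    show "\<forall>p\<in>{p. p permutes UNIV} - {p. p permutes ?T}. of_int (sign p) * (\<Prod>r\<in>UNIV. A $ r $ p r) = 0"
    proof
      fix p assume "p \<in> {p. p permutes UNIV} - {p. p permutes ?T}"
      then obtain r where "r \<notin> ?T" "p r \<noteq> r"
        using permutes_superset[of p UNIV ?T] by auto
      then have "A $ r $ p r = 0" using A[of r "p r"] by auto
      then show "of_int (sign p) * (\<Prod>r\<in>UNIV. A $ r $ p r) = 0"
        by (simp add: prod_zero_iff) blast
    qed
  qed
  also have "\<dots> = (\<Sum>p | p permutes ?T. of_int (sign p) * (\<Prod>r\<in>?T. A $ r $ p r))"
  proof (rule sum.cong[OF refl])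
    fix p assume "p \<in> {p. p permutes ?T}"
    then have "A $ r $ p r = 1" if "r \<notin> ?T" for r
      using A[OF that] that by (auto simp: permutes_def)
    then have "(\<Prod>r\<in>UNIV. A $ r $ p r) = (\<Prod>r\<in>?T. A $ r $ p r)"
      by (intro prod.mono_neutral_right) auto
    then show "of_int (sign p) * (\<Prod>r\<in>UNIV. A $ r $ p r) = of_int (sign p) * (\<Prod>r\<in>?T. A $ r $ p r)"
      by simp
  qed
  finally have det: "det A = (\<Sum>p | p permutes ?T. of_int (sign p) * (\<Prod>r\<in>?T. A $ r $ p r))" .
  have f: "finite {j, k}" "i \<notin> {j, k}" "finite {k}" "j \<notin> {k}" using ijk by auto
  show ?thesis
    unfolding det sum_over_permutations_insert[OF f(1,2)] sum_over_permutations_insert[OF f(3,4)]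
      permutes_sing
    using ijk by (simp add: sign_swap_id permutation_swap_id sign_compose sign_id swap_id_eq)
qed

definition emb :: "'n \<Rightarrow> 'n \<Rightarrow> 'n \<Rightarrow> real \<times> real \<times> real \<Rightarrow> real^'n" where
  "emb i j k = (\<lambda>(a, b, c). a *\<^sub>R axis i 1 + b *\<^sub>R axis j 1 + c *\<^sub>R axis k 1)"

fun det3 :: "real \<times> real \<times> real \<Rightarrow> real \<times> real \<times> real \<Rightarrow> real \<times> real \<times> real \<Rightarrow> real" where
  "det3 (a1, a2, a3) (b1, b2, b3) (c1, c2, c3) =
    a1 * (b2 * c3 - b3 * c2) - a2 * (b1 * c3 - b3 * c1) + a3 * (b1 * c2 - b2 * c1)"

text \<open>Carries the three standard generators to \<open>a\<close>, \<open>b\<close>,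
  \<open>c\<close> while fixing the complementary coordinates; the matrix restricts to the block
  with columns \<open>a\<close>, \<open>b\<close>, \<open>c\<close>.\<close>

lemma block_map:
  fixes i j k :: "'n::finite"
  assumes ijk: "i \<noteq> j" "i \<noteq> k" "j \<noteq> k"
  obtains L :: "real^'n \<Rightarrow> real^'n" where "linear L"
    "\<And>x. x $ i = 0 \<Longrightarrow> x $ j = 0 \<Longrightarrow> x $ k = 0 \<Longrightarrow> L x = x"
    "\<And>p q r. L (emb i j k (p, q, r)) = p *\<^sub>R emb i j k a + q *\<^sub>R emb i j k b + r *\<^sub>R emb i j k c"
    "\<And>S. compact S \<Longrightarrow> measure lebesgue (L ` S) = \<bar>det3 a b c\<bar> * measure lebesgue S"
proof
  let ?E = "emb i j k"
  define L where "L x = x + (x $ i) *\<^sub>R (?E a - axis i 1) + (x $ j) *\<^sub>R (?E b - axis j 1)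
      + (x $ k) *\<^sub>R (?E c - axis k 1)" for x :: "real^'n"
  show lin: "linear L"
    by (rule linearI) (auto simp: L_def algebra_simps)
  show "L x = x" if "x $ i = 0" "x $ j = 0" "x $ k = 0" for x
    using that by (simp add: L_def)
  show "L (?E (p, q, r)) = p *\<^sub>R ?E a + q *\<^sub>R ?E b + r *\<^sub>R ?E c" for p q r
  proof -
    have "?E (p, q, r) $ i = p" "?E (p, q, r) $ j = q" "?E (p, q, r) $ k = r"
      using ijk by (auto simp: emb_def axis_def)
    moreover have "?E (p, q, r) = p *\<^sub>R axis i 1 + q *\<^sub>R axis j 1 + r *\<^sub>R axis k 1"
      by (simp add: emb_def)
    ultimately show ?thesis by (simp add: L_def algebra_simps)
  qed
  obtain a1 a2 a3 b1 b2 b3 c1 c2 c3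
    where abc: "a = (a1, a2, a3)" "b = (b1, b2, b3)" "c = (c1, c2, c3)"
    by (metis prod_cases3)
  have "det (matrix L) = det3 a b c"
    using ijk by (subst det_three_rows[OF ijk])
      (auto simp: abc matrix_def L_def emb_def axis_def algebra_simps)
  then show "measure lebesgue (L ` S) = \<bar>det3 a b c\<bar> * measure lebesgue S" if "compact S" for S
    using measure_linear_image_det[OF lin lmeasurable_compact[OF that]] by simp
qed

text \<open>As a function of the generators the volume is multi-affine, homogeneous of degree 3 and
  zero below three generators, so it is the sum of its values on triples. \<open>block_map\<close>
  reduces each triple to the standard one.\<close>

lemma volume_plus_zono:
  fixes i j k :: "'n::finite" and Q :: "(real^'n) set"
  assumes ijk: "i \<noteq> j" "i \<noteq> k" "j \<noteq> k"
    and Q: "compact Q" "convex Q" "Q \<subseteq> {x. x $ i = 0 \<and> x $ j = 0 \<and> x $ k = 0}"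
  shows "measure lebesgue (Q + zono (image_mset (emb i j k) (mset xs)))
    = measure lebesgue (Q + zono (image_mset (emb i j k) {#(1, 0, 0), (0, 1, 0), (0, 0, 1)#}))
      * triple_sum (\<lambda>a b c. \<bar>det3 a b c\<bar>) xs"
proof -
  let ?E = "emb i j k"
  define V where "V M = measure lebesgue (Q + zono (image_mset ?E M))" for M
  define \<kappa> where "\<kappa> = V {#(1, 0, 0), (0, 1, 0), (0, 0, 1)#}"
  have comp: "compact (Q + zono M)" and conv: "convex (Q + zono M)" for M
    using Q by (auto intro!: compact_set_plus convex_set_plus compact_zono convex_zono)
  have fixQ: "L ` Q = Q" if "\<And>x. x $ i = 0 \<Longrightarrow> x $ j = 0 \<Longrightarrow> x $ k = 0 \<Longrightarrow> L x = x" for L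
    using that Q(3) by (force simp: image_iff)
  have V3: "V {#a, b, c#} = \<bar>det3 a b c\<bar> * \<kappa>" for a b c
  proof -
    obtain L where L: "linear L" "\<And>x. x $ i = 0 \<Longrightarrow> x $ j = 0 \<Longrightarrow> x $ k = 0 \<Longrightarrow> L x = x"
      "\<And>p q r. L (?E (p, q, r)) = p *\<^sub>R ?E a + q *\<^sub>R ?E b + r *\<^sub>R ?E c"
      "\<And>S. compact S \<Longrightarrow> measure lebesgue (L ` S) = \<bar>det3 a b c\<bar> * measure lebesgue S"
      using block_map[OF ijk] by metis
    have img: "L ` (Q + zono (image_mset ?E {#(1, 0, 0), (0, 1, 0), (0, 0, 1)#}))
        = Q + zono (image_mset ?E {#a, b, c#})"
      by (subst linear_image_set_plus[OF L(1)], subst linear_image_zono[OF L(1)], subst fixQ[OF L(2)])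
        (simp_all add: L(3))
    show ?thesis unfolding V_def \<kappa>_def img[symmetric] by (rule L(4)[OF comp])
  qed
  have aff: "multi_affine V"
    unfolding multi_affine_def
  proof (intro allI)
    fix x M
    have "Q + zono (image_mset ?E (add_mset x N)) = closed_segment 0 (?E x) + (Q + zono (image_mset ?E N))" for N
      by (simp add: add_ac)
    then show "V (add_mset x (add_mset x M)) - V (add_mset x M) = V (add_mset x M) - V M"
      unfolding V_def using volume_add_segment_affine[OF comp conv] by presburger
  qed
  \<comment> \<open>Only the coordinates \<open>i\<close>, \<open>j\<close>, \<open>k\<close> are
    stretched: \<open>Q\<close> stays fixed, and the factor is 8.\<close>
  have hom: "V (M + M) = 2 ^ 3 * V M" for M
  proof -
    obtain L where L: "linear L" "\<And>x. x $ i = 0 \<Longrightarrow> x $ j = 0 \<Longrightarrow> x $ k = 0 \<Longrightarrow> L x = x"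
      "\<And>p q r. L (?E (p, q, r)) = p *\<^sub>R ?E (2, 0, 0) + q *\<^sub>R ?E (0, 2, 0) + r *\<^sub>R ?E (0, 0, 2)"
      "\<And>S. compact S \<Longrightarrow> measure lebesgue (L ` S) = \<bar>det3 (2, 0, 0) (0, 2, 0) (0, 0, 2)\<bar> * measure lebesgue S"
      using block_map[OF ijk, of "(2, 0, 0)" "(0, 2, 0)" "(0, 0, 2)"] by blast
    have "L (?E x) = 2 *\<^sub>R ?E x" for x
      by (cases x) (simp add: L(3), simp add: emb_def algebra_simps)
    then have "image_mset L (image_mset ?E M) = image_mset (\<lambda>x. 2 *\<^sub>R x) (image_mset ?E M)"
      by (simp add: image_mset.compositionality o_def)
    then have img: "L ` (Q + zono (image_mset ?E M)) = Q + zono (image_mset ?E (M + M))"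
      by (subst linear_image_set_plus[OF L(1)], subst linear_image_zono[OF L(1)], subst fixQ[OF L(2)])
        (simp_all only: zono_double image_mset_union)
    show ?thesis unfolding V_def img[symmetric] using L(4)[OF comp] by simp
  qed
  have small: "V M = 0" if "size M < 3" for M
  proof -
    \<comment> \<open>A zero generator leaves the body unchanged, so \<open>M\<close> is padded to a
      triple containing \<open>?z\<close>, whose determinant vanishes.\<close>
    let ?z = "(0, 0, 0) :: real \<times> real \<times> real"
    have z: "V (add_mset ?z N) = V N" for N
      by (simp add: V_def emb_def)
    have "size M = 0 \<or> size M = 1 \<or> size M = Suc 1" using that by arith
    then consider "M = {#}" | x where "M = {#x#}" | x y where "M = {#x, y#}"
      by (metis size_eq_0_iff_empty size_1_singleton_mset size_eq_Suc_imp_eq_union size_Suc_Diff1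
          add_mset_eq_single add_mset_remove_trivial diff_Suc_1 size_add_mset)
    then obtain a b where "V M = V {#?z, a, b#}"
      by cases (metis z add_mset_commute)+
    then show ?thesis by (cases a; cases b) (simp add: V3)
  qed
  have "V (mset xs) = triple_sum (\<lambda>a b c. V (mset [a, b, c])) xs"
    using multi_affine_homogeneous_eq[OF aff, of 3 xs] hom small sum_subseqs_3[of "\<lambda>S. V (mset S)" xs]
    by simp
  also have "\<dots> = triple_sum (\<lambda>a b c. \<kappa> * \<bar>det3 a b c\<bar>) xs"
    by (simp add: V3 mult.commute)
  also have "\<dots> = \<kappa> * triple_sum (\<lambda>a b c. \<bar>det3 a b c\<bar>) xs"
    by (rule triple_sum_mult)
  finally show ?thesis by (simp add: V_def \<kappa>_def)
qed

section \<open>Projections and volume ratios\<close>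

lemma hyperplane_proj_emb:
  assumes "i \<noteq> j" "i \<noteq> k" "j \<noteq> k"
  shows "hyperplane_proj (axis k 1) (emb i j k (a, b, c)) = emb i j k (a, b, 0)"
proof -
  have "emb i j k (a, b, c) $ k = c" using assms by (simp add: emb_def axis_def)
  then show ?thesis by (simp add: hyperplane_proj_def inner_axis) (simp add: emb_def)
qed

lemma linear_hyperplane_proj: "linear (hyperplane_proj u)"
  by (rule linearI) (simp_all add: hyperplane_proj_def algebra_simps)

text \<open>The projection of a zonotope is generated by the projected generators, and the prism
  over it has the axis of projection as one more generator.\<close>

lemma hausdorff_measure_proj_zono:
  fixes i j k :: "'n::finite"
  assumes ijk: "i \<noteq> j" "i \<noteq> k" "j \<noteq> k"
    and N: "set_mset N \<subseteq> {x. x $ i = 0 \<and> x $ j = 0 \<and> x $ k = 0}"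
    and "h > 0" and h: "hausdorff_measure (CARD('n) - 1) (face k 1 (0 :: real^'n)) = ennreal h"
  shows "hausdorff_measure (CARD('n) - 1)
      (hyperplane_proj (axis k 1) ` zono (N + image_mset (emb i j k) (mset xs)))
    = ennreal (h * measure lebesgue (zono (N + image_mset (emb i j k)
        (mset ((0, 0, 1) # map (\<lambda>(a, b, c). (a, b, 0)) xs)))))"
proof -
  let ?E = "emb i j k" and ?p = "hyperplane_proj (axis k 1) :: real^'n \<Rightarrow> real^'n"
  define M where "M = N + image_mset ?E (mset (map (\<lambda>(a, b, c). (a, b, 0)) xs))"
  have "image_mset ?p N = image_mset (\<lambda>x. x) N"
    using N by (intro image_mset_cong) (auto simp: hyperplane_proj_def inner_axis)
  moreover have "?p (?E x) = ?E (case x of (a, b, c) \<Rightarrow> (a, b, 0))" for x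
    using hyperplane_proj_emb[OF ijk] by (cases x) simp
  ultimately have img: "?p ` zono (N + image_mset ?E (mset xs)) = zono M"
    by (simp add: linear_image_zono[OF linear_hyperplane_proj] M_def image_mset.compositionality o_def)
  have "set_mset M \<subseteq> {x. x $ k = 0}"
    using N ijk by (auto simp: M_def emb_def axis_def)
  then have "zono M \<subseteq> {x. x $ k = 0}"
    by (intro zono_subset_subspace) (auto simp: subspace_def)
  then have "hausdorff_measure (CARD('n) - 1) (zono M)
      = ennreal (h * measure lebesgue (zono M + closed_segment 0 (axis k 1)))"
    by (intro hausdorff_measure_convex compact_zono convex_zono \<open>h > 0\<close> h)
  also have "zono M + closed_segment 0 (axis k 1) = zono (add_mset (?E (0, 0, 1)) M)"
    by (simp add: emb_def add.commute)
  finally show ?thesis unfolding img by (simp add: M_def)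
qed

text \<open>Volume and projected measure both carry the factor \<kappa>, so the contribution of
  \<open>N\<close> cancels and only the constant \<open>h\<close> remains.\<close>

lemma zono_ratio:
  fixes i j k :: "'n::finite"
  assumes ijk: "i \<noteq> j" "i \<noteq> k" "j \<noteq> k"
    and N: "set_mset N \<subseteq> {x. x $ i = 0 \<and> x $ j = 0 \<and> x $ k = 0}"
    and "h > 0" and h: "hausdorff_measure (CARD('n) - 1) (face k 1 (0 :: real^'n)) = ennreal h"
  defines "\<kappa> \<equiv> measure lebesgue (zono (N + image_mset (emb i j k) {#(1, 0, 0), (0, 1, 0), (0, 0, 1)#}))"
  shows "measure lebesgue (zono (N + image_mset (emb i j k) (mset xs)))
      = \<kappa> * triple_sum (\<lambda>a b c. \<bar>det3 a b c\<bar>) xs"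
    and "\<kappa> > 0 \<Longrightarrow> measure lebesgue (zono (N + image_mset (emb i j k) (mset xs)))
        / enn2real (hausdorff_measure (CARD('n) - 1)
            (hyperplane_proj (axis k 1) ` zono (N + image_mset (emb i j k) (mset xs))))
      = triple_sum (\<lambda>a b c. \<bar>det3 a b c\<bar>) xs
        / (h * triple_sum (\<lambda>a b c. \<bar>det3 a b c\<bar>) ((0, 0, 1) # map (\<lambda>(a, b, c). (a, b, 0)) xs))"
proof -
  let ?t = "triple_sum (\<lambda>a b c. \<bar>det3 a b c\<bar>)"
  have Q: "compact (zono N)" "convex (zono N)" "zono N \<subseteq> {x. x $ i = 0 \<and> x $ j = 0 \<and> x $ k = 0}"
    using N by (intro compact_zono convex_zono zono_subset_subspace; simp add: subspace_def)+
  have vol: "measure lebesgue (zono (N + image_mset (emb i j k) (mset xs))) = \<kappa> * ?t xs" for xs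
    unfolding zono_union[of N] \<kappa>_def by (rule volume_plus_zono[OF ijk Q])
  show "measure lebesgue (zono (N + image_mset (emb i j k) (mset xs))) = \<kappa> * ?t xs" by (rule vol)
  show "measure lebesgue (zono (N + image_mset (emb i j k) (mset xs)))
        / enn2real (hausdorff_measure (CARD('n) - 1)
            (hyperplane_proj (axis k 1) ` zono (N + image_mset (emb i j k) (mset xs))))
      = ?t xs / (h * ?t ((0, 0, 1) # map (\<lambda>(a, b, c). (a, b, 0)) xs))" if "\<kappa> > 0"
    unfolding hausdorff_measure_proj_zono[OF ijk N \<open>h > 0\<close> h]
    using \<open>h > 0\<close> that
    by (subst enn2real_ennreal, simp, unfold vol) (simp del: triple_sum.simps)
qed

section \<open>The explicit counterexample\<close>

theorem theorem4:
  assumes "CARD('n::finite) \<ge> 3"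
  shows "\<exists>(A :: (real ^ 'n) set) (B :: (real ^ 'n) set) (u :: real ^ 'n).
    zonoid A \<and> full_dimensional A \<and> zonoid B \<and> full_dimensional B \<and> norm u = 1 \<and>
    measure lebesgue (A + B)
        / enn2real (hausdorff_measure (CARD('n) - 1) (hyperplane_proj u ` (A + B)))
    < measure lebesgue A
        / enn2real (hausdorff_measure (CARD('n) - 1) (hyperplane_proj u ` A))
      + measure lebesgue B
        / enn2real (hausdorff_measure (CARD('n) - 1) (hyperplane_proj u ` B))"
proof -
  obtain T :: "'n set" where "card T = 3"
    using obtain_subset_with_card_n[OF assms] by metis
  then obtain i j k :: 'n where ijk: "i \<noteq> j" "i \<noteq> k" "j \<noteq> k"
    unfolding card_3_iff by blast
  obtain h where h: "hausdorff_measure (CARD('n) - 1) (face k 1 (0 :: real^'n)) = ennreal h" "h > 0"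
    using hausdorff_measure_unit_face_finite[of k] hausdorff_measure_unit_face_pos[of k]
    by (cases "hausdorff_measure (CARD('n) - 1) (face k 1 (0 :: real^'n))") auto
  let ?E = "emb i j k"
  \<comment> \<open>Unit segments in the remaining directions; none when the dimension is 3. The sum
    \<open>A + B\<close> contains each of them twice, which changes \<kappa> but not the
    ratio.\<close>
  define N :: "(real^'n) multiset" where "N = image_mset (\<lambda>r. axis r 1) (mset_set (UNIV - {i, j, k}))"
  have N: "set_mset N \<subseteq> {x. x $ i = 0 \<and> x $ j = 0 \<and> x $ k = 0}"
    by (auto simp: N_def axis_def)
  then have NN: "set_mset (N + N) \<subseteq> {x. x $ i = 0 \<and> x $ j = 0 \<and> x $ k = 0}" by simp
  define la :: "(real \<times> real \<times> real) list"
    where "la = [(1, 0, 0), (0, 1, 0), (1, 1, 1), (1, 1, -1)]"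
  define lb :: "(real \<times> real \<times> real) list"
    where "lb = [(1, 0, 0), (0, 1, 0), (1, -1, 1), (1, -1, -1)]"
  let ?t = "triple_sum (\<lambda>a b c. \<bar>det3 a b c\<bar>)"
  let ?s = "\<lambda>xs. ?t ((0, 0, 1) # map (\<lambda>(a, b, c). (a, b, 0)) xs)"
  have t: "?t la = 6" "?t lb = 6" "?t (la @ lb) = 64"
    by (simp_all add: la_def lb_def)
  \<comment> \<open>Within \<open>la\<close>, and likewise within \<open>lb\<close>, the last two
    generators have equal projections and span no area. In the sum, (1,1) and (1,-1) do span area,
    which raises 5 + 5 to 28.\<close>
  have s: "?s la = 5" "?s lb = 5" "?s (la @ lb) = 28"
    by (simp_all add: la_def lb_def)
  define A where "A = zono (N + image_mset ?E (mset la))"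
  define B where "B = zono (N + image_mset ?E (mset lb))"
  have AB: "A + B = zono (N + N + image_mset ?E (mset (la @ lb)))"
    by (simp add: A_def B_def zono_union add_ac)
  define \<kappa> where "\<kappa> N = measure lebesgue (zono (N + image_mset ?E {#(1, 0, 0), (0, 1, 0), (0, 0, 1)#}))" for N
  \<comment> \<open>All coordinate axes occur exactly once among these generators; the inclusion of
    the unit cube gives positive volume.\<close>
  have box: "cbox 0 1 \<subseteq> zono (N + image_mset ?E {#(1, 0, 0), (0, 1, 0), (0, 0, 1)#})"
  proof
    fix x :: "real^'n" assume x: "x \<in> cbox 0 1"
    have "N + image_mset ?E {#(1, 0, 0), (0, 1, 0), (0, 0, 1)#}
        = image_mset (\<lambda>r. axis r 1) (mset_set (UNIV - {i, j, k}) + mset_set {i, j, k})"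
      using ijk by (simp add: N_def emb_def)
    also have "mset_set (UNIV - {i, j, k}) + mset_set {i, j, k} = mset_set UNIV"
      by (subst mset_set_Union[symmetric]) auto
    finally have "zono (N + image_mset ?E {#(1, 0, 0), (0, 1, 0), (0, 0, 1)#})
        = (\<Sum>r\<in>UNIV. closed_segment 0 (axis r 1))"
      by (simp add: zono_def sum_unfold_sum_mset image_mset.compositionality o_def)
    moreover have "x = (\<Sum>r\<in>UNIV. x $ r *\<^sub>R axis r 1)"
      by (simp add: vec_eq_iff axis_def if_distrib cong: if_cong)
    moreover have "x $ r *\<^sub>R axis r 1 \<in> closed_segment 0 (axis r 1)" for r
      using x by (auto simp: in_segment mem_box_cart)
    ultimately show "x \<in> zono (N + image_mset ?E {#(1, 0, 0), (0, 1, 0), (0, 0, 1)#})"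
      by (auto simp: set_sum_alt)
  qed
  also have "zono M \<subseteq> zono (N + M)" for M
    using zero_in_zono[of N] set_plus_intro[of 0 "zono N"] by (fastforce simp: zono_union)
  finally have box2: "cbox 0 1 \<subseteq> zono (N + N + image_mset ?E {#(1, 0, 0), (0, 1, 0), (0, 0, 1)#})"
    by (simp add: add.assoc)
  have pos: "0 < measure lebesgue (zono M)" if "cbox 0 1 \<subseteq> zono M" for M :: "(real^'n) multiset"
  proof -
    have "measure lebesgue (cbox 0 (1 :: real^'n)) \<le> measure lebesgue (zono M)"
      using that by (intro measure_mono_fmeasurable) (auto intro: lmeasurable_compact compact_zono)
    moreover have "measure lebesgue (cbox 0 (1 :: real^'n)) = 1"
      by (subst measure_lebesgue_cbox_cart) auto
    ultimately show ?thesis by simp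
  qed
  have \<kappa>: "\<kappa> N > 0" "\<kappa> (N + N) > 0"
    unfolding \<kappa>_def by (rule pos, rule box, rule pos, rule box2)
  note ratio = zono_ratio[OF ijk N h(2,1), folded \<kappa>_def]
  have "full_dimensional A" "full_dimensional B"
    unfolding A_def B_def using \<kappa> t by (intro full_dimensional_convex convex_zono; simp add: ratio(1))+
  moreover have "zonoid A" "zonoid B"
    unfolding A_def B_def by (rule zonoid_zono)+
  \<comment> \<open>With \<open>h\<close> cleared this reads 64 * 5 = 320 < 336 = 12 * 28.\<close>
  moreover have "(64 :: real) / (h * 28) < 6 / (h * 5) + 6 / (h * 5)"
    using h(2) by (simp add: field_simps)
  then have "measure lebesgue (A + B)
        / enn2real (hausdorff_measure (CARD('n) - 1) (hyperplane_proj (axis k 1) ` (A + B)))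
    < measure lebesgue A
        / enn2real (hausdorff_measure (CARD('n) - 1) (hyperplane_proj (axis k 1) ` A))
      + measure lebesgue B
        / enn2real (hausdorff_measure (CARD('n) - 1) (hyperplane_proj (axis k 1) ` B))"
    unfolding AB unfolding A_def B_def ratio(2)[OF \<kappa>(1)]
      zono_ratio(2)[OF ijk NN h(2,1), folded \<kappa>_def, OF \<kappa>(2)] s t .
  moreover have "norm (axis k 1 :: real^'n) = 1" by simp
  ultimately show ?thesis by blast
qed

end
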